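(* Let $q$ be a power of an odd prime, let $c,d\in\mathbb{F}_q$ with $c\neq 0$, $d\neq 0,1$ and $d$ a non-square in $\mathbb{F}_q$, and let $\mathbf{C}$ be the Edwards curve $u^2+v^2=c^2(1+du^2v^2)$ over $\mathbb{F}_q$. Let $f\in\mathbb{F}_q(\mathbf{C})$ be a rational function such that $\Omega_1$ or $\Omega_2$ is a pole of $f$. Let $G\in\mathbf{C}(\mathbb{F}_q)$ be a point of order $t$ and put $w_n=f(nG)$, $n=1,2,\dots$. Then \[ L(w_n,N)\geq \min\left\{\frac{t-\deg f}{4\deg f},\ \frac{N-\deg f}{4\deg f+1}\right\}\quad\text{for all } N\geq \deg f . \]
   Context: The $\mathbb{F}_q$-rational points of $\mathbf{C}$ form an abelian group with neutral element $(0,c)$ under the addition $(u_1,v_1)\oplus(u_2,v_2)=\left(\frac{u_1v_2+u_2v_1}{c(1+du_1u_2v_1v_2)},\frac{v_1v_2-u_1u_2}{c(1-du_1u_2v_1v_2)}\right)$; $nG$ denotes the $n$-fold sum of $G$. In the projective closure $U^2Z^2+V^2Z^2=c(Z^4+dU^2V^2)$ of $\mathbf{C}$ the two points at infinity (defined over $\mathbb{F}_{q^2}$) are $\Omega_1=(1:0:0)$ and $\Omega_2=(0:1:0)$. For a rational function $f$, $\deg f$ denotes the degree of its pole divisor (e.g. the coordinate functions $u,v$ have degree $2$). The linear complexity profile $L(s_n,N)$ of a sequence $(s_n)$ over $\mathbb{F}_q$ is the length $L$ of a shortest linear recurrence $s_{n+L}=c_{L-1}s_{n+L-1}+\dots+c_0s_n$,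 $0\le n\le N-L-1$, with $c_i\in\mathbb{F}_q$, satisfied by the first $N$ terms; by convention $L(s_n,N)=0$ if the first $N$ terms are all zero and $L(s_n,N)=N$ if $s_0=\dots=s_{N-2}=0\neq s_{N-1}$. *)

theory Defs
  imports Complex_Main
    "HOL-Computational_Algebra.Computational_Algebra"
    "HOL-Algebra.Multiplicative_Group"
    "HOL-Algebra.Algebraic_Closure_Type"
begin

section \<open>The Edwards curve and its rational points\<close>

definition edwards_points :: "'a::field \<Rightarrow> 'a \<Rightarrow> ('a \<times> 'a) set" where
  "edwards_points c d = {(x, y). x^2 + y^2 = c^2 * (1 + d * x^2 * y^2)}"

definition edwards_add :: "'a::field \<Rightarrow> 'a \<Rightarrow> 'a \<times> 'a \<Rightarrow> 'a \<times> 'a \<Rightarrow> 'a \<times> 'a" where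
  "edwards_add c d = (\<lambda>(u1, v1) (u2, v2).
     ((u1 * v2 + u2 * v1) / (c * (1 + d * u1 * u2 * v1 * v2)),
      (v1 * v2 - u1 * u2) / (c * (1 - d * u1 * u2 * v1 * v2))))"

text \<open>
  The multiplicative notation of the algebra library is used for this additive group: the
  n-fold sum of a point is its n-th power.
\<close>

definition edwards_group :: "'a::field \<Rightarrow> 'a \<Rightarrow> ('a \<times> 'a) monoid" where
  "edwards_group c d =
     \<lparr>carrier = edwards_points c d, monoid.mult = edwards_add c d, one = (0, c)\<rparr>"


section \<open>The function field\<close>

text \<open>
  With \<open>k\<close> the algebraic closure of the base field, all functions live in the algebraic closure
  of \<open>k(u)\<close>. There \<open>u\<close> is the transcendental generator and \<open>v\<close> a root of the curve equation
  over \<open>k(u)\<close>, which is quadratic in \<open>v\<close>. The roots are \<open>v\<close> and \<open>-v\<close>, so the field generated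
  by \<open>u\<close> and \<open>v\<close> does not depend on the choice.
\<close>

type_synonym 'a fun_univ = "'a alg_closure poly fract alg_closure"

definition geom_const :: "'a::field alg_closure \<Rightarrow> 'a fun_univ" where
  "geom_const a = to_ac (to_fract [:a:])"

definition base_const :: "'a::field \<Rightarrow> 'a fun_univ" where
  "base_const a = geom_const (to_ac a)"

definition coord_u :: "'a::field fun_univ" where
  "coord_u = to_ac (to_fract [:0, 1:])"

definition coord_v :: "'a::field \<Rightarrow> 'a \<Rightarrow> 'a fun_univ" where
  "coord_v c d = (SOME y. coord_u^2 + y^2 = base_const c^2 * (1 + base_const d * coord_u^2 * y^2))"

text \<open>A bivariate polynomial is a polynomial in \<open>v\<close> whose coefficients are polynomials in \<open>u\<close>.\<close>

definition eval2 :: "'b::comm_ring_1 poly poly \<Rightarrow> 'b \<Rightarrow> 'b \<Rightarrow> 'b" where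
  "eval2 p x y = poly (poly p [:y:]) x"

definition base_fun :: "'a::field \<Rightarrow> 'a \<Rightarrow> 'a poly poly \<Rightarrow> 'a fun_univ" where
  "base_fun c d p = eval2 (map_poly (map_poly base_const) p) coord_u (coord_v c d)"

definition geom_fun :: "'a::field \<Rightarrow> 'a \<Rightarrow> 'a alg_closure poly poly \<Rightarrow> 'a fun_univ" where
  "geom_fun c d p = eval2 (map_poly (map_poly geom_const) p) coord_u (coord_v c d)"

definition base_function_field :: "'a::field \<Rightarrow> 'a \<Rightarrow> 'a fun_univ set" where
  "base_function_field c d = {base_fun c d p / base_fun c d r | p r. base_fun c d r \<noteq> 0}"

definition geom_function_field :: "'a::field \<Rightarrow> 'a \<Rightarrow> 'a fun_univ set" where
  "geom_function_field c d = {geom_fun c d p / geom_fun c d r | p r. geom_fun c d r \<noteq> 0}"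

text \<open>
  The function \<open>f\<close> is regular at the affine rational point \<open>P\<close> and takes the value \<open>y\<close> there.
\<close>

definition has_value_at :: "'a::field \<Rightarrow> 'a \<Rightarrow> 'a fun_univ \<Rightarrow> 'a \<times> 'a \<Rightarrow> 'a \<Rightarrow> bool" where
  "has_value_at c d f P y \<longleftrightarrow>
     (\<exists>p r. base_fun c d r \<noteq> 0 \<and> f = base_fun c d p / base_fun c d r \<and>
            eval2 r (fst P) (snd P) \<noteq> 0 \<and>
            y = eval2 p (fst P) (snd P) / eval2 r (fst P) (snd P))"


section \<open>Places, poles and degree\<close>

text \<open>
  The places of the curve over the algebraic closure, that is the points of its nonsingular
  projective model, given by their normalized discrete valuations. A valuation is a function on
  the whole ambient type, so its value is fixed to be \<open>0\<close> at \<open>0\<close> and outside the function field;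
  this makes distinct members of the set distinct places. All places have degree one.
\<close>

definition places :: "'a::field \<Rightarrow> 'a \<Rightarrow> ('a fun_univ \<Rightarrow> int) set" where
  "places c d = {ord.
     (\<forall>z. z \<notin> geom_function_field c d - {0} \<longrightarrow> ord z = 0) \<and>
     (\<forall>x \<in> geom_function_field c d - {0}. \<forall>y \<in> geom_function_field c d - {0}.
        ord (x * y) = ord x + ord y) \<and>
     (\<forall>x \<in> geom_function_field c d - {0}. \<forall>y \<in> geom_function_field c d - {0}.
        x + y \<noteq> 0 \<longrightarrow> min (ord x) (ord y) \<le> ord (x + y)) \<and>
     (\<forall>a. ord (geom_const a) = 0) \<and>
     (\<exists>z \<in> geom_function_field c d. ord z = 1)}"

text \<open>
  The points at infinity are singular, so several places can lie over each of them. The place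
  \<open>ord\<close> lies over \<open>(1:0:0)\<close> iff the affine coordinates \<open>V/U = v/u\<close> and \<open>Z/U = 1/u\<close> of the
  chart \<open>U = 1\<close> both vanish at it; similarly for \<open>(0:1:0)\<close>.
\<close>

definition places_over_Omega1 :: "'a::field \<Rightarrow> 'a \<Rightarrow> ('a fun_univ \<Rightarrow> int) set" where
  "places_over_Omega1 c d =
     {ord \<in> places c d. 0 < ord (coord_v c d / coord_u) \<and> 0 < ord (1 / coord_u)}"

definition places_over_Omega2 :: "'a::field \<Rightarrow> 'a \<Rightarrow> ('a fun_univ \<Rightarrow> int) set" where
  "places_over_Omega2 c d =
     {ord \<in> places c d. 0 < ord (coord_u / coord_v c d) \<and> 0 < ord (1 / coord_v c d)}"

definition pole_at_Omega1 :: "'a::field \<Rightarrow> 'a \<Rightarrow> 'a fun_univ \<Rightarrow> bool" where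
  "pole_at_Omega1 c d f \<longleftrightarrow> (\<exists>ord \<in> places_over_Omega1 c d. ord f < 0)"

definition pole_at_Omega2 :: "'a::field \<Rightarrow> 'a \<Rightarrow> 'a fun_univ \<Rightarrow> bool" where
  "pole_at_Omega2 c d f \<longleftrightarrow> (\<exists>ord \<in> places_over_Omega2 c d. ord f < 0)"

definition function_degree :: "'a::field \<Rightarrow> 'a \<Rightarrow> 'a fun_univ \<Rightarrow> nat" where
  "function_degree c d f = (\<Sum>ord \<in> {ord \<in> places c d. ord f < 0}. nat (- ord f))"


section \<open>Linear complexity profile\<close>

definition linear_complexity :: "(nat \<Rightarrow> 'a::field) \<Rightarrow> nat \<Rightarrow> nat" where
  "linear_complexity s N =
     (LEAST L. \<exists>a :: nat \<Rightarrow> 'a. \<forall>n. n + L < N \<longrightarrow> s (n + L) = (\<Sum>i<L. a i * s (n + i)))"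

text \<open>The usual conventions for the degenerate cases are consequences of the definition.\<close>

lemma linear_complexity_zero:
  fixes s :: "nat \<Rightarrow> 'a::field"
  assumes "\<And>n. n < N \<Longrightarrow> s n = 0"
  shows "linear_complexity s N = 0"
proof -
  have "linear_complexity s N \<le> 0"
    unfolding linear_complexity_def by (rule Least_le) (use assms in simp)
  then show ?thesis by simp
qed

lemma linear_complexity_last:
  fixes s :: "nat \<Rightarrow> 'a::field"
  assumes "\<And>n. n < N \<Longrightarrow> s n = 0" and "s N \<noteq> 0"
  shows "linear_complexity s (Suc N) = Suc N"
  unfolding linear_complexity_def
proof (rule Least_equality)
  show "\<exists>a :: nat \<Rightarrow> 'a. \<forall>n. n + Suc N < Suc N \<longrightarrow>
          s (n + Suc N) = (\<Sum>i<Suc N. a i * s (n + i))"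
    by simp
next
  fix L
  assume "\<exists>a :: nat \<Rightarrow> 'a. \<forall>n. n + L < Suc N \<longrightarrow> s (n + L) = (\<Sum>i<L. a i * s (n + i))"
  then obtain a :: "nat \<Rightarrow> 'a" where
    a: "\<And>n. n + L < Suc N \<Longrightarrow> s (n + L) = (\<Sum>i<L. a i * s (n + i))" by blast
  show "Suc N \<le> L"
  proof (rule ccontr)
    assume "\<not> Suc N \<le> L"
    then have L: "L \<le> N" by simp
    have "s N = (\<Sum>i<L. a i * s (N - L + i))" using a[of "N - L"] L by simp
    also have "\<dots> = 0" by (rule sum.neutral) (use L assms(1) in auto)
    finally show False using assms(2) by simp
  qed
qed


section \<open>The generic point lies on the curve\<close>

lemma coord_v_equation:
  fixes c d :: "'a::field"
  assumes "c \<noteq> 0"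
  shows "coord_u^2 + coord_v c d^2 = base_const c^2 * (1 + base_const d * coord_u^2 * coord_v c d^2)"
proof -
  let ?h = "\<lambda>q. to_ac (to_fract (q :: 'a alg_closure poly))"
  let ?C = "base_const c" and ?D = "base_const d" and ?u = "coord_u :: 'a fun_univ"
  define q where "q = 1 - [:to_ac c:]^2 * [:to_ac d:] * [:0, 1:]^2"
  have h: "?h q = 1 - ?C^2 * ?D * ?u^2"
    unfolding q_def base_const_def geom_const_def coord_u_def power2_eq_square
    by (simp only: to_fract_diff to_fract_mult to_fract_1 to_ac_diff to_ac_mult to_ac_1)
  have "poly q 0 = 1" by (simp add: q_def)
  then have "q \<noteq> 0" by auto
  then have nz: "1 - ?C^2 * ?D * ?u^2 \<noteq> 0"
    by (metis h to_ac_eq_0_iff to_fract_eq_0_iff)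
  obtain y :: "'a fun_univ" where y: "y^2 = (?C^2 - ?u^2) / (1 - ?C^2 * ?D * ?u^2)"
    using nth_root_exists[of 2 "(?C^2 - ?u^2) / (1 - ?C^2 * ?D * ?u^2)"] by auto
  have "?u^2 + y^2 = ?C^2 * (1 + ?D * ?u^2 * y^2)"
  proof -
    have "y^2 * (1 - ?C^2 * ?D * ?u^2) = ?C^2 - ?u^2" using y nz by simp
    then show ?thesis by (simp add: algebra_simps)
  qed
  then show ?thesis unfolding coord_v_def by (rule someI)
qed

end

theory Submission
  imports Defs
begin

text \<open>
  Suppose that the first \<open>N\<close> terms satisfy a linear recurrence of length \<open>L\<close> with coefficients
  \<open>a\<^sub>i\<close>, and put \<open>F(P) = f(P + L G) - (\<Sum>i<L. a\<^sub>i f(P + i G))\<close>. Translation by a rational point is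
  an automorphism of the function field and permutes the places, so \<open>F\<close> has at most
  \<open>(L + 1) deg f\<close> poles, while it vanishes at \<open>n G\<close> for \<open>1 \<le> n \<le> min (N - L) t\<close>. If \<open>F \<noteq> 0\<close>, this
  bounds \<open>min (N - L) t\<close> by \<open>(L + 1) deg f\<close>. If \<open>F = 0\<close>, let \<open>\<Omega>\<close> be a pole of \<open>f\<close> at infinity. The \<open>t\<close>
  translates of \<open>\<Omega>\<close> by multiples of \<open>G\<close> are distinct, and the recurrence forces a pole of \<open>f\<close> among any
  \<open>L\<close> consecutive ones, so \<open>t \<le> L deg f\<close>.

  That a function has no more zeros than poles is seen on the norm to \<open>k(u)\<close>, using for each point of
  the projective line the places given by Laurent expansions of \<open>u\<close> and \<open>v\<close>.
\<close>

section \<open>The group law\<close>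

text \<open>One construction serves twice: substituting for (u, v) a point (U, V) of the curve over
  a larger field, with U not constant. With coordinates in the function field it is translation,
  with Laurent series it is local expansion. It is well defined and injective because 1 and V are
  linearly independent over k(U), which holds as the numerator and the denominator of v^2 do not
  differ by a square factor. On rational points the addition law has no exceptions because d is a
  nonsquare. Over k, however, d is a square, so sums involving the generic point need their own
  nonvanishing argument, again by independence of 1 and v. The points at infinity are singular, and
  translation by (0, -c) fixes both of them. That the translates of a pole are distinct is therefore
  proved for places: the value of the coordinate that stays finite tells a place from its image. The
  degree of f sums over all places, so it bounds the poles found among those given by explicit
  expansions.\<close>

lemma edwards_assoc_fst:
  fixes x1 :: "'b::field"
  assumes "x1^2+y1^2 = 1+d*x1^2*y1^2" "x2^2+y2^2 = 1+d*x2^2*y2^2" "x3^2+y3^2 = 1+d*x3^2*y3^2" 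
  shows "((x1*y2+x2*y1)*(1-d*x1*x2*y1*y2)*y3 + x3*(y1*y2-x1*x2)*(1+d*x1*x2*y1*y2)) *
    ((1+d*x2*x3*y2*y3)*(1-d*x2*x3*y2*y3)+d*x1*y1*(x2*y3+x3*y2)*(y2*y3-x2*x3))
  = ((x2*y3+x3*y2)*(1-d*x2*x3*y2*y3)*y1 + x1*(y2*y3-x2*x3)*(1+d*x2*x3*y2*y3)) *
    ((1+d*x1*x2*y1*y2)*(1-d*x1*x2*y1*y2)+d*x3*y3*(x1*y2+x2*y1)*(y1*y2-x1*x2))"
  using assms by Groebner_Basis.algebra

text \<open>As for the first coordinates: the equality of the two triple sums for c = 1,
  cross-multiplied after clearing the inner denominators, is a polynomial consequence of the three
  curve equations. \<open>edwards_add_assoc1\<close> puts the denominators back.\<close>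

lemma edwards_assoc_snd:
  fixes x1 :: "'b::field"
  assumes "x1^2+y1^2 = 1+d*x1^2*y1^2" "x2^2+y2^2 = 1+d*x2^2*y2^2" "x3^2+y3^2 = 1+d*x3^2*y3^2" 
  shows "((y1*y2-x1*x2)*(1+d*x1*x2*y1*y2)*y3 - x3*(x1*y2+x2*y1)*(1-d*x1*x2*y1*y2)) *
    ((1+d*x2*x3*y2*y3)*(1-d*x2*x3*y2*y3)-d*x1*y1*(x2*y3+x3*y2)*(y2*y3-x2*x3))
  = ((y2*y3-x2*x3)*(1+d*x2*x3*y2*y3)*y1 - x1*(x2*y3+x3*y2)*(1-d*x2*x3*y2*y3)) *
    ((1+d*x1*x2*y1*y2)*(1-d*x1*x2*y1*y2)-d*x3*y3*(x1*y2+x2*y1)*(y1*y2-x1*x2))"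
  using assms by Groebner_Basis.algebra

lemma edwards_closed_aux:
  fixes x1 :: "'b::field"
  assumes "x1^2+y1^2 = 1+d*x1^2*y1^2" "x2^2+y2^2 = 1+d*x2^2*y2^2"
  shows "(x1*y2+x2*y1)^2*(1-d*x1*x2*y1*y2)^2 + (y1*y2-x1*x2)^2*(1+d*x1*x2*y1*y2)^2 =
    (1+d*x1*x2*y1*y2)^2*(1-d*x1*x2*y1*y2)^2 + d*(x1*y2+x2*y1)^2*(y1*y2-x1*x2)^2"
  using assms by Groebner_Basis.algebra

text \<open>Both denominators of the sum are nonzero. As an explicit condition it lets the same
  identities serve for rational points and for points over the function field, where exceptional
  pairs exist.\<close>

definition edwards_regular :: "'b::field \<Rightarrow> 'b \<times> 'b \<Rightarrow> 'b \<times> 'b \<Rightarrow> bool" where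
  "edwards_regular d P Q \<longleftrightarrow>
     1 + d * fst P * fst Q * snd P * snd Q \<noteq> 0 \<and> 1 - d * fst P * fst Q * snd P * snd Q \<noteq> 0"

lemma edwards_add_commute: "edwards_add c d P Q = edwards_add c d Q P"
  by (simp add: edwards_add_def split: prod.split) (simp add: algebra_simps)

lemma edwards_add_closed1:
  assumes "P \<in> edwards_points 1 d" "Q \<in> edwards_points 1 d" "edwards_regular d P Q"
  shows "edwards_add 1 d P Q \<in> edwards_points 1 d"
proof -
  obtain x1 y1 x2 y2 where PQ: "P = (x1, y1)" "Q = (x2, y2)" by (cases P, cases Q) auto
  define p m where "p = 1 + d*x1*x2*y1*y2" and "m = 1 - d*x1*x2*y1*y2"
  have nz: "p \<noteq> 0" "m \<noteq> 0" using assms(3) by (auto simp: PQ edwards_regular_def p_def m_def)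
  have "(x1*y2+x2*y1)^2*m^2 + (y1*y2-x1*x2)^2*p^2 = p^2*m^2 + d*(x1*y2+x2*y1)^2*(y1*y2-x1*x2)^2"
    unfolding p_def m_def by (rule edwards_closed_aux) (use assms in \<open>simp_all add: PQ edwards_points_def\<close>)
  then have "((x1*y2+x2*y1)/p)^2 + ((y1*y2-x1*x2)/m)^2 = 1 + d*((x1*y2+x2*y1)/p)^2*((y1*y2-x1*x2)/m)^2"
    using nz by (simp add: field_simps)
  then show ?thesis by (simp add: PQ edwards_points_def edwards_add_def p_def m_def mult_ac)
qed

lemma edwards_add_assoc1:
  fixes P Q R :: "'b::field \<times> 'b"
  assumes "P \<in> edwards_points 1 d" "Q \<in> edwards_points 1 d" "R \<in> edwards_points 1 d"
    and "edwards_regular d P Q" "edwards_regular d Q R"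
    and "edwards_regular d (edwards_add 1 d P Q) R" "edwards_regular d P (edwards_add 1 d Q R)"
  shows "edwards_add 1 d (edwards_add 1 d P Q) R = edwards_add 1 d P (edwards_add 1 d Q R)"
proof -
  obtain x1 y1 x2 y2 x3 y3 where PQ: "P = (x1, y1)" "Q = (x2, y2)" "R = (x3, y3)"
    by (cases P, cases Q, cases R) auto
  define p m a b where "p = 1 + d*x1*x2*y1*y2" and "m = 1 - d*x1*x2*y1*y2"
    and "a = x1*y2+x2*y1" and "b = y1*y2-x1*x2"
  define p' m' a' b' where "p' = 1 + d*x2*x3*y2*y3" and "m' = 1 - d*x2*x3*y2*y3"
    and "a' = x2*y3+x3*y2" and "b' = y2*y3-x2*x3"
  have nz: "p \<noteq> 0" "m \<noteq> 0" "p' \<noteq> 0" "m' \<noteq> 0"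
    using assms(4,5) by (auto simp: PQ edwards_regular_def p_def m_def p'_def m'_def)
  have s: "edwards_add 1 d P Q = (a/p, b/m)" "edwards_add 1 d Q R = (a'/p', b'/m')"
    by (simp_all add: PQ edwards_add_def p_def m_def a_def b_def p'_def m'_def a'_def b'_def mult_ac)
  define t t' where "t = d*x3*y3*a*b" and "t' = d*x1*y1*a'*b'"
  have k: "1 + d*(a/p)*x3*(b/m)*y3 = (p*m+t)/(p*m)" "1 - d*(a/p)*x3*(b/m)*y3 = (p*m-t)/(p*m)"
     "1 + d*x1*(a'/p')*y1*(b'/m') = (p'*m'+t')/(p'*m')" "1 - d*x1*(a'/p')*y1*(b'/m') = (p'*m'-t')/(p'*m')"
    using nz by (simp_all add: t_def t'_def add_divide_distrib diff_divide_distrib mult_ac)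
  have nz2: "p*m+t \<noteq> 0" "p*m-t \<noteq> 0" "p'*m'+t' \<noteq> 0" "p'*m'-t' \<noteq> 0"
    using assms(6,7) unfolding s unfolding PQ edwards_regular_def fst_conv snd_conv k by auto
  have on: "x1^2+y1^2 = 1+d*x1^2*y1^2" "x2^2+y2^2 = 1+d*x2^2*y2^2" "x3^2+y3^2 = 1+d*x3^2*y3^2"
    using assms(1-3) by (auto simp: PQ edwards_points_def)
  have 1: "(a*m*y3 + x3*b*p) * (p'*m'+t') = (a'*m'*y1 + x1*b'*p') * (p*m+t)"
    unfolding a_def b_def p_def m_def a'_def b'_def p'_def m'_def t_def t'_def by (rule edwards_assoc_fst[OF on])
  have 2: "(b*p*y3 - x3*a*m) * (p'*m'-t') = (b'*p'*y1 - x1*a'*m') * (p*m-t)"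
    unfolding a_def b_def p_def m_def a'_def b'_def p'_def m'_def t_def t'_def by (rule edwards_assoc_snd[OF on])
  have q: "(z/(g*h))/(w/(g*h)) = z/w" if "g \<noteq> 0" "h \<noteq> 0" for z w g h :: 'b
    using that by simp
  have l: "edwards_add 1 d (a/p, b/m) R = ((a*m*y3 + x3*b*p)/(p*m+t), (b*p*y3 - x3*a*m)/(p*m-t))"
  proof -
    have "edwards_add 1 d (a/p, b/m) R =
      ((a/p*y3 + x3*(b/m))/((p*m+t)/(p*m)), (b/m*y3 - a/p*x3)/((p*m-t)/(p*m)))"
      unfolding k[symmetric] PQ edwards_add_def by (simp only: split_conv mult_1_left)
    moreover have "a/p*y3 + x3*(b/m) = (a*m*y3 + x3*b*p)/(p*m)" "b/m*y3 - a/p*x3 = (b*p*y3 - x3*a*m)/(p*m)"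
      using nz by (simp_all add: add_frac_eq diff_frac_eq mult_ac)
    ultimately show ?thesis by (simp only: q[OF nz(1,2)])
  qed
  have r: "edwards_add 1 d P (a'/p', b'/m') = ((a'*m'*y1 + x1*b'*p')/(p'*m'+t'), (b'*p'*y1 - x1*a'*m')/(p'*m'-t'))"
  proof -
    have "edwards_add 1 d P (a'/p', b'/m') =
      ((x1*(b'/m') + a'/p'*y1)/((p'*m'+t')/(p'*m')), (y1*(b'/m') - x1*(a'/p'))/((p'*m'-t')/(p'*m')))"
      unfolding k[symmetric] PQ edwards_add_def by (simp only: split_conv mult_1_left)
    moreover have "x1*(b'/m') + a'/p'*y1 = (a'*m'*y1 + x1*b'*p')/(p'*m')" "y1*(b'/m') - x1*(a'/p') = (b'*p'*y1 - x1*a'*m')/(p'*m')"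
      using nz by (simp_all add: add_frac_eq diff_frac_eq mult_ac)
    ultimately show ?thesis by (simp only: q[OF nz(3,4)])
  qed
  show ?thesis unfolding s l r prod.inject frac_eq_eq[OF nz2(1,3)] frac_eq_eq[OF nz2(2,4)] using 1 2 ..
qed

text \<open>Dividing coordinates by c leads to the curve with parameters 1 and d c^4 and respects
  addition, which keeps c out of the large polynomial identities.\<close>

lemma edwards_points_scale:
  fixes c :: "'b::field"
  assumes "c \<noteq> 0"
  shows "(x, y) \<in> edwards_points c d \<longleftrightarrow> (x/c, y/c) \<in> edwards_points 1 (d*c^4)"
  proof -
  have "(x/c)^2 + (y/c)^2 = (x^2+y^2)/c^2" "1*(1+(d*c^4)*(x/c)^2*(y/c)^2) = 1+d*x^2*y^2"
    using assms by (simp_all add: power_divide add_divide_distrib power4_eq_xxxx power2_eq_square)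
  then show ?thesis using assms
    unfolding edwards_points_def mem_Collect_eq split_conv one_power2 by (metis divide_eq_eq mult.commute mult_1 power_eq_0_iff)(*(simp add: divide_eq_eq mult.commute)*)
qed

lemma edwards_add_scale:
  fixes c :: "'b::field"
  assumes "c \<noteq> 0"
  shows "map_prod (\<lambda>x. x/c) (\<lambda>x. x/c) (edwards_add c d P Q) =
    edwards_add 1 (d*c^4) (map_prod (\<lambda>x. x/c) (\<lambda>x. x/c) P) (map_prod (\<lambda>x. x/c) (\<lambda>x. x/c) Q)"
proof -
  obtain x1 y1 x2 y2 where PQ: "P = (x1, y1)" "Q = (x2, y2)" by (cases P, cases Q) auto
  have "d*c^4*(x1/c)*(x2/c)*(y1/c)*(y2/c) = d*x1*x2*y1*y2"
    using assms by (simp add: power4_eq_xxxx)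
  moreover have "x1/c*(y2/c) + x2/c*(y1/c) = (x1*y2+x2*y1)/(c*c)" "y1/c*(y2/c) - x1/c*(x2/c) = (y1*y2-x1*x2)/(c*c)"
    by (simp_all add: add_divide_distrib diff_divide_distrib)
  ultimately show ?thesis by (simp add: PQ edwards_add_def mult_ac)
qed

lemma edwards_regular_scale:
  fixes c :: "'b::field"
  assumes "c \<noteq> 0"
  shows "edwards_regular d P Q \<longleftrightarrow>
    edwards_regular (d*c^4) (map_prod (\<lambda>x. x/c) (\<lambda>x. x/c) P) (map_prod (\<lambda>x. x/c) (\<lambda>x. x/c) Q)"
proof -
  obtain x1 y1 x2 y2 where PQ: "P = (x1, y1)" "Q = (x2, y2)" by (cases P, cases Q) auto
  have "d*c^4*(x1/c)*(x2/c)*(y1/c)*(y2/c) = d*x1*x2*y1*y2"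
    using assms by (simp add: power4_eq_xxxx)
  then show ?thesis by (simp add: PQ edwards_regular_def)
qed

lemma edwards_points_scale':
  fixes c :: "'b::field"
  assumes "c \<noteq> 0"
  shows "P \<in> edwards_points c d \<longleftrightarrow> map_prod (\<lambda>x. x/c) (\<lambda>x. x/c) P \<in> edwards_points 1 (d*c^4)"
  using edwards_points_scale[OF assms] by (cases P) simp

lemma edwards_add_closed:
  fixes c :: "'b::field"
  assumes "c \<noteq> 0" "P \<in> edwards_points c d" "Q \<in> edwards_points c d" "edwards_regular d P Q"
  shows "edwards_add c d P Q \<in> edwards_points c d"
  using edwards_add_closed1[of "map_prod (\<lambda>x. x/c) (\<lambda>x. x/c) P" "d*c^4" "map_prod (\<lambda>x. x/c) (\<lambda>x. x/c) Q"] assms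
  by (simp add: edwards_points_scale'[OF \<open>c \<noteq> 0\<close>] edwards_add_scale[OF \<open>c \<noteq> 0\<close>] edwards_regular_scale[OF \<open>c \<noteq> 0\<close>, of d])

lemma edwards_add_assoc:
  fixes c :: "'b::field"
  assumes c: "c \<noteq> 0" and "P \<in> edwards_points c d" "Q \<in> edwards_points c d" "R \<in> edwards_points c d"
    and "edwards_regular d P Q" "edwards_regular d Q R"
    and "edwards_regular d (edwards_add c d P Q) R" "edwards_regular d P (edwards_add c d Q R)"
  shows "edwards_add c d (edwards_add c d P Q) R = edwards_add c d P (edwards_add c d Q R)"
proof -
  let ?s = "map_prod (\<lambda>x. x/c) (\<lambda>x. x/c)"
  have "inj ?s" using c by (auto intro!: injI)
  moreover have "?s (edwards_add c d (edwards_add c d P Q) R) = ?s (edwards_add c d P (edwards_add c d Q R))"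
    unfolding edwards_add_scale[OF c] using assms(2-)
    by (intro edwards_add_assoc1)
      (simp_all add: edwards_points_scale'[OF c] edwards_regular_scale[OF c, of d] edwards_add_scale[OF c])
  ultimately show ?thesis by (metis injD)
qed

section \<open>Completeness of the addition law and the group of rational points\<close>

locale edwards_curve =
  fixes c d :: "'a::field"
  assumes c: "c \<noteq> 0" and two: "(2::'a) \<noteq> 0" and nonsquare: "\<nexists>x. d = x^2"
begin

lemma d: "d \<noteq> 0" using nonsquare by (metis zero_power2)

text \<open>If \<open>e = d u1 u2 v1 v2\<close> were \<open>1\<close> or \<open>-1\<close>, then \<open>d = ((u1 + e v1) / (u1 v1 (u2 + v2)))\<^sup>2\<close> or, when
  \<open>u2 + v2 = 0\<close>, \<open>d = ((u1 - e v1) / (u1 v1 (u2 - v2)))\<^sup>2\<close>.\<close>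

lemma edwards_complete_aux:
  assumes "(u1, v1) \<in> edwards_points c d" "(u2, v2) \<in> edwards_points c d"
  shows "(d*u1*u2*v1*v2)^2 \<noteq> 1"
proof
  define e where "e = d*u1*u2*v1*v2"
  assume "(d*u1*u2*v1*v2)^2 = 1"
  then have e1: "e^2 = 1" by (simp add: e_def)
  then have nz: "u1 \<noteq> 0" "v1 \<noteq> 0" "u2 \<noteq> 0" "v2 \<noteq> 0" by (auto simp: e_def)
  have on: "u1^2+v1^2 = c^2*(1+d*u1^2*v1^2)" "u2^2+v2^2 = c^2*(1+d*u2^2*v2^2)"
    using assms by (auto simp: edwards_points_def)
  have p: "(u1+e*v1)^2 = d*(u1*v1*(u2+v2))^2" using on e1 e_def by Groebner_Basis.algebra
  have m: "(u1-e*v1)^2 = d*(u1*v1*(u2-v2))^2" using on e1 e_def by Groebner_Basis.algebra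
  have *: "z = 0" if "y^2 = d*z^2" for y z
    proof (rule ccontr)
    assume "z \<noteq> 0"
    then have "d = (y/z)^2" using that by (simp add: power_divide)
    then show False using nonsquare by blast
  qed
  have "u2+v2 = 0" "u2-v2 = 0" using *[OF p] *[OF m] nz by auto
  then have "2*u2 = 0" by Groebner_Basis.algebra
  then show False using two nz by simp
qed

lemma edwards_complete:
  assumes "P \<in> edwards_points c d" "Q \<in> edwards_points c d"
  shows "edwards_regular d P Q"
proof -
  have "(d*fst P*fst Q*snd P*snd Q)^2 \<noteq> 1"
    by (rule edwards_complete_aux) (use assms in auto)
  then have "d*fst P*fst Q*snd P*snd Q \<noteq> 1" "d*fst P*fst Q*snd P*snd Q \<noteq> -1" by auto
  then show ?thesis unfolding edwards_regular_def
    by (metis add_eq_0_iff eq_iff_diff_eq_0)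
qed

lemma add_closed:
  "\<lbrakk>P \<in> edwards_points c d; Q \<in> edwards_points c d\<rbrakk> \<Longrightarrow> edwards_add c d P Q \<in> edwards_points c d"
  by (simp add: edwards_add_closed edwards_complete c)

lemma zero_point: "(0, c) \<in> edwards_points c d"
  by (simp add: edwards_points_def)

lemma edwards_group_comm_group: "comm_group (edwards_group c d)"
proof (rule comm_groupI)
  fix P assume P: "P \<in> carrier (edwards_group c d)"
  obtain x y where xy: "P = (x, y)" by (cases P)
  have on: "(x, y) \<in> edwards_points c d" using P by (simp add: edwards_group_def xy)
  then have on': "(-x, y) \<in> edwards_points c d" by (simp add: edwards_points_def)
  have "1 - d*(-x)*x*y*y \<noteq> 0"
    using edwards_complete[OF on' on] by (simp add: edwards_regular_def)
  \<comment> \<open>The inverse of (x, y) is (-x, y): by the curve equation the second coordinate of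
    their sum reduces to c.\<close>
  moreover have "y*y+x*x = c*c*(1-d*(-x)*x*y*y)"
    using on by (simp add: edwards_points_def power2_eq_square algebra_simps)
  ultimately have "edwards_add c d (-x, y) P = (0, c)"
    using c by (simp add: edwards_add_def xy add.commute)
  then show "\<exists>Q\<in>carrier (edwards_group c d). Q \<otimes>\<^bsub>edwards_group c d\<^esub> P = \<one>\<^bsub>edwards_group c d\<^esub>"
    using on' by (intro bexI[of _ "(-x, y)"]) (auto simp: edwards_group_def)
next
  fix P assume "P \<in> carrier (edwards_group c d)"
  then show "\<one>\<^bsub>edwards_group c d\<^esub> \<otimes>\<^bsub>edwards_group c d\<^esub> P = P"
    using c by (cases P) (simp add: edwards_group_def edwards_add_def)
next
  fix P Q R
  assume "P \<in> carrier (edwards_group c d)" "Q \<in> carrier (edwards_group c d)" "R \<in> carrier (edwards_group c d)"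
  then show "P \<otimes>\<^bsub>edwards_group c d\<^esub> Q \<otimes>\<^bsub>edwards_group c d\<^esub> R =
     P \<otimes>\<^bsub>edwards_group c d\<^esub> (Q \<otimes>\<^bsub>edwards_group c d\<^esub> R)"
    by (auto simp: edwards_group_def intro!: edwards_add_assoc c edwards_complete add_closed)
qed (auto simp: edwards_group_def zero_point add_closed edwards_add_commute)

end

section \<open>Evaluation of polynomials along ring homomorphisms\<close>

definition ring_hom_total :: "('x::comm_ring_1 \<Rightarrow> 'y::comm_ring_1) \<Rightarrow> bool" where
  "ring_hom_total h \<longleftrightarrow> h 1 = 1 \<and> (\<forall>x y. h (x + y) = h x + h y) \<and> (\<forall>x y. h (x * y) = h x * h y)"

lemma ring_hom_total_simps:
  assumes "ring_hom_total h"
  shows "h 0 = 0" "h 1 = 1" "h (x + y) = h x + h y" "h (x * y) = h x * h y" "h (- x) = - h x"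
    "h (x - y) = h x - h y" "h (x ^ n) = h x ^ n"
proof -
  show 1: "h 1 = 1" and add: "\<And>x y. h (x + y) = h x + h y" and mult: "\<And>x y. h (x * y) = h x * h y"
    using assms by (auto simp: ring_hom_total_def)
  show 0: "h 0 = 0" using add[of 0 0] by simp
  show neg: "\<And>x. h (- x) = - h x" using add 0 by (metis add.right_inverse eq_neg_iff_add_eq_0 add.commute)
  show "h (x - y) = h x - h y" using add[of x "- y"] neg[of y] by simp
  show "h (x ^ n) = h x ^ n" by (induction n) (simp_all add: 1 mult)
qed

text \<open>Nested as \<open>poly_hom (poly_hom h U) V\<close> it evaluates a bivariate polynomial
  at (U, V), so that two uses of one lemma show this to be a ring homomorphism.\<close>

definition poly_hom :: "('x::comm_ring_1 \<Rightarrow> 'y::comm_ring_1) \<Rightarrow> 'y \<Rightarrow> 'x poly \<Rightarrow> 'y" where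
  "poly_hom h y p = poly (map_poly h p) y"

lemma poly_hom_pCons:
  "h 0 = 0 \<Longrightarrow> poly_hom h y (pCons a p) = h a + y * poly_hom h y p"
  unfolding poly_hom_def by (cases "a = 0 \<and> p = 0") (auto simp: map_poly_pCons)

lemma poly_hom_0: "poly_hom h y 0 = 0"
  by (simp add: poly_hom_def)

lemma ring_hom_total_poly_hom:
  assumes h: "ring_hom_total h"
  shows "ring_hom_total (poly_hom h y)"
proof -
  note s = ring_hom_total_simps[OF h]
  note c = poly_hom_pCons[of h y, OF s(1)]
  have add: "poly_hom h y (p + q) = poly_hom h y p + poly_hom h y q" for p q
  proof (induction p arbitrary: q)
    case (pCons a p)
    obtain b r where "q = pCons b r" by (cases q)
    then show ?case by (simp add: c s pCons.IH algebra_simps)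
  qed (simp add: poly_hom_0)
  have smult: "poly_hom h y (smult a p) = h a * poly_hom h y p" for a p
    by (induction p) (simp_all add: poly_hom_0 c s algebra_simps)
  have "poly_hom h y (p * q) = poly_hom h y p * poly_hom h y q" for p q
    by (induction p) (simp_all add: poly_hom_0 c s add smult algebra_simps)
  then show ?thesis by (simp add: ring_hom_total_def add) (simp add: one_pCons c s poly_hom_0)
qed

lemma eval2_map_poly:
  assumes h: "ring_hom_total h"
  shows "eval2 (map_poly (map_poly h) p) x y = poly_hom (poly_hom h x) y p"
proof (induction p)
  case (pCons a p)
  have "map_poly h 0 = 0" by simp
  then have "map_poly (map_poly h) (pCons a p) = pCons (map_poly h a) (map_poly (map_poly h) p)"
    by (cases "a = 0 \<and> p = 0") (auto simp: map_poly_pCons)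
  then show ?case
    using pCons by (simp add: eval2_def poly_hom_pCons poly_hom_0) (simp add: poly_hom_def)
qed (simp add: eval2_def poly_hom_0)

lemma poly_hom_const: "h 0 = 0 \<Longrightarrow> poly_hom h y [:a:] = h a"
  by (simp add: poly_hom_pCons poly_hom_0)

text \<open>Over an algebraically closed field p splits into linear factors, and none of them
  vanishes at a non-constant y. Hence being outside the range of h already means being
  transcendental over it.\<close>

lemma poly_hom_nonzero:
  fixes h :: "'x::alg_closed_field \<Rightarrow> 'y::field"
  assumes h: "ring_hom_total h" and y: "y \<notin> range h" and p: "p \<noteq> 0"
  shows "poly_hom h y p \<noteq> 0"
  using p
proof (induction "degree p" arbitrary: p)
  case 0
  then obtain a where a: "p = [:a:]" "a \<noteq> 0" by (metis degree_eq_zeroE pCons_0_0)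
  have "h a * h (inverse a) = 1" using a(2) by (simp flip: ring_hom_total_simps[OF h])
  then show ?case by (auto simp: a poly_hom_const ring_hom_total_simps(1)[OF h])
next
  case (Suc n)
  then obtain a where "poly p a = 0" using alg_closed_imp_poly_has_root[of p] by auto
  then obtain q where q: "p = [:- a, 1:] * q" by (auto simp: poly_eq_0_iff_dvd)
  then have "q \<noteq> 0" using Suc.prems by auto
  then have "degree q = n" using q Suc.hyps(2) by (simp add: degree_mult_eq del: mult_pCons_left)
  then have "poly_hom h y q \<noteq> 0" using Suc.hyps(1) \<open>q \<noteq> 0\<close> by blast
  moreover have "poly_hom h y [:- a, 1:] \<noteq> 0"
    using y by (auto simp: poly_hom_pCons poly_hom_0 ring_hom_total_simps[OF h])
  ultimately show ?case
    unfolding q by (simp only: ring_hom_total_simps(4)[OF ring_hom_total_poly_hom[OF h]] mult_eq_0_iff) simp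
qed

section \<open>Specializations of the function field\<close>

text \<open>The chosen fraction is immaterial at a generic point, by \<open>spec_eq\<close>. The
  value 0 outside the function field matches the convention for places, so composing a valuation
  with it again obeys that convention.\<close>

definition specialize :: "'a::field \<Rightarrow> 'a \<Rightarrow> ('a alg_closure \<Rightarrow> 'l::field) \<Rightarrow> 'l \<Rightarrow> 'l \<Rightarrow> 'a fun_univ \<Rightarrow> 'l" where
  "specialize c d h U V z =
     (if z \<in> geom_function_field c d
      then case SOME (p, r). geom_fun c d r \<noteq> 0 \<and> z = geom_fun c d p / geom_fun c d r of
        (p, r) \<Rightarrow> poly_hom (poly_hom h U) V p / poly_hom (poly_hom h U) V r
      else 0)"

lemma ring_hom_total_geom_const: "ring_hom_total geom_const"
  by (auto simp: ring_hom_total_def geom_const_def simp flip: to_ac_add to_ac_mult to_fract_add to_fract_mult one_pCons)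

lemma ring_hom_total_base_const: "ring_hom_total base_const"
  using ring_hom_total_simps[OF ring_hom_total_geom_const]
  by (auto simp: ring_hom_total_def base_const_def)

lemma geom_fun_eq: "geom_fun c d p = poly_hom (poly_hom geom_const coord_u) (coord_v c d) p"
  unfolding geom_fun_def by (rule eval2_map_poly[OF ring_hom_total_geom_const])

lemma base_fun_eq: "base_fun c d p = poly_hom (poly_hom base_const coord_u) (coord_v c d) p"
  unfolding base_fun_def by (rule eval2_map_poly[OF ring_hom_total_base_const])

lemma poly_hom_map:
  assumes "h 0 = 0" and g: "g 0 = 0" "\<And>x. h (g x) = h' x"
  shows "poly_hom h y (map_poly g p) = poly_hom h' y p"
proof -
  have "h' 0 = 0" using assms by metis
  then show ?thesis
    using assms unfolding poly_hom_def by (simp add: map_poly_map_poly comp_def)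
qed

section \<open>The function field as a quadratic extension of k(u)\<close>

context edwards_curve
begin

text \<open>\<open>[:c\<^sup>2, 0, -1:]\<close> and \<open>[:1, 0, -c\<^sup>2 d:]\<close>: numerator and denominator of \<open>v\<^sup>2\<close> over \<open>k(u)\<close>.\<close>

definition vnum :: "'a alg_closure poly" where
  "vnum = [:to_ac c ^ 2, 0, - 1:]"

definition vden :: "'a alg_closure poly" where
  "vden = [:1, 0, - (to_ac c ^ 2 * to_ac d):]"

lemma vnum_nonzero [simp]: "vnum \<noteq> 0" and vden_nonzero [simp]: "vden \<noteq> 0"
  by (auto simp: vnum_def vden_def)

text \<open>At u^2 = c^2, where \<open>vnum\<close> vanishes, \<open>vden\<close> has the value 1 -
  c^4 d. So this keeps the roots of the two polynomials apart.\<close>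

lemma c4d: "c^4 * d \<noteq> 1"
proof
  assume "c^4 * d = 1"
  then have "d = (1/c^2)^2" using c by (simp add: field_simps power2_eq_square power4_eq_xxxx)
  then show False using nonsquare by blast
qed

lemma two_ac: "(2::'a alg_closure) \<noteq> 0"
  using two by (metis to_ac_eq_0_iff to_ac_numeral)

lemma poly_vden_at_c: "poly vden (to_ac c) \<noteq> 0"
proof -
  have "poly vden (to_ac c) = to_ac (1 - c^4*d)"
    by (simp add: vden_def power4_eq_xxxx power2_eq_square mult_ac)
  then show ?thesis using c4d by (simp del: to_ac_diff)
qed

text \<open>The order at \<open>c\<close> of the left side is even, that of the right side is odd.\<close>

lemma vsq_not_square:
  assumes "p^2 * vden = q^2 * vnum"
  shows "p = 0 \<and> q = 0"
proof (rule ccontr)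
  assume "\<not> ?thesis"
  moreover have "p = 0 \<longleftrightarrow> q = 0"
    using arg_cong[OF assms, of "\<lambda>x. x = 0"] by simp
  ultimately have nz: "p \<noteq> 0" "q \<noteq> 0" by auto
  let ?C = "to_ac c"
  have C: "?C \<noteq> 0" using c by simp
  have vnum: "vnum = [:-?C, 1:] * [:-?C, -1:]" by (simp add: vnum_def power2_eq_square)
  have "order ?C [:-?C, -1:] = 0"
  proof (rule order_0I)
    have "poly [:-?C, -1:] ?C = -?C + ?C * -1" by simp
    also have "\<dots> = - (2 * ?C)" by Groebner_Basis.algebra
    finally show "poly [:-?C, -1:] ?C \<noteq> 0" using C two_ac by (metis neg_equal_0_iff_equal no_zero_divisors)
  qed
  moreover have "order ?C [:-?C, 1:] = 1"
    using order_power_n_n[of ?C 1] by simp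
  ultimately have 1: "order ?C vnum = 1"
    unfolding vnum by (simp only: order_mult[OF vnum_nonzero[unfolded vnum]] add_0_right)
  have 2: "order ?C vden = 0" using poly_vden_at_c by (rule order_0I)
  have "order ?C (p^2 * vden) = 2 * order ?C p + order ?C vden"
    using nz order_mult[of "p^2" vden] order_mult[of p p] by (simp add: power2_eq_square)
  moreover have "order ?C (q^2 * vnum) = 2 * order ?C q + order ?C vnum"
    using nz order_mult[of "q^2" vnum] order_mult[of q q] by (simp add: power2_eq_square)
  ultimately have "2 * order ?C p = 2 * order ?C q + 1" unfolding assms 1 2 by (simp only:)
  then show False by presburger
qed

text \<open>Pseudo-division, as polynomials in v, by the curve equation \<open>vden\<close> v^2 -
  \<open>vnum\<close>. The power of \<open>vden\<close> pays for the leading coefficient, which has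
  no inverse among polynomials in u.\<close>

lemma curve_reduce:
  "\<exists>n p0 p1 h. [:vden^n:] * p = [:p0, p1:] + [:- vnum, 0, vden:] * h"
proof (induction p)
  case 0
  show ?case by (rule exI[of _ 0], rule exI[of _ 0], rule exI[of _ 0], rule exI[of _ 0]) simp
next
  case (pCons a p)
  then obtain n p0 p1 h where IH: "[:vden^n:] * p = [:p0, p1:] + [:- vnum, 0, vden:] * h" by blast
  have "[:vden^(Suc n):] * pCons a p = [:vden^Suc n * a:] + [:0, vden:] * ([:vden^n:] * p)"
    by (simp add: mult.commute[of vden "vden ^ n"])
  also have "\<dots> = [:vden^Suc n * a + vnum * p1, vden * p0:] + [:- vnum, 0, vden:] * ([:0, vden:] * h + [:p1:])"
    unfolding IH by (simp add: algebra_simps)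
  finally show ?case by blast
qed

end

text \<open>A point of the curve over an extension l of the constants, embedded by h. As U is not
  constant, it is transcendental, and the point lies on no other curve over the constants.\<close>

locale generic_point = edwards_curve c d for c d :: "'a::field" +
  fixes h :: "'a alg_closure \<Rightarrow> 'l::field" and U V :: 'l
  assumes hom: "ring_hom_total h" and U: "U \<notin> range h"
    and curve: "U^2 + V^2 = h (to_ac c)^2 * (1 + h (to_ac d) * U^2 * V^2)"
begin

abbreviation "ev1 \<equiv> poly_hom h U"
abbreviation "ev2 \<equiv> poly_hom (poly_hom h U) V"

lemmas h_simps = ring_hom_total_simps[OF hom]
lemma ev1_hom: "ring_hom_total ev1" by (rule ring_hom_total_poly_hom[OF hom])
lemma ev2_hom: "ring_hom_total ev2" by (rule ring_hom_total_poly_hom[OF ev1_hom])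
lemmas ev1_simps = ring_hom_total_simps[OF ev1_hom]
lemmas ev2_simps = ring_hom_total_simps[OF ev2_hom]

lemma ev1_nonzero: "p \<noteq> 0 \<Longrightarrow> ev1 p \<noteq> 0"
  by (rule poly_hom_nonzero[OF hom U])

lemma ev1_eq_0_iff [simp]: "ev1 p = 0 \<longleftrightarrow> p = 0"
  using ev1_nonzero poly_hom_0 by metis

lemma ev1_vden_V: "ev1 vden * V^2 = ev1 vnum"
  using curve by (simp add: vden_def vnum_def poly_hom_pCons poly_hom_0 h_simps algebra_simps power2_eq_square)

lemma ev2_linear: "ev2 [:p0, p1:] = ev1 p0 + V * ev1 p1"
  by (simp add: poly_hom_pCons[of ev1, OF ev1_simps(1)] poly_hom_0)

lemma ev2_reduce:
  assumes "[:vden^n:] * p = [:p0, p1:] + [:- vnum, 0, vden:] * k"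
  shows "ev1 vden^n * ev2 p = ev1 p0 + V * ev1 p1"
proof -
  have "ev2 ([:vden^n:] * p) = ev1 vden^n * ev2 p"
    by (simp only: ev2_simps poly_hom_const[of ev1, OF ev1_simps(1)] ev1_simps)
  moreover have "ev2 [:- vnum, 0, vden:] = 0"
    using ev1_vden_V by (simp add: poly_hom_pCons[of ev1, OF ev1_simps(1)] poly_hom_0 ev1_simps algebra_simps power2_eq_square)
  ultimately show ?thesis unfolding assms ev2_simps ev2_linear by simp
qed

text \<open>The norm of p0 + V p1 down to the rational functions of U, freed of its denominator. By
  \<open>vsq_not_square\<close> it vanishes only for p0 = p1 = 0, hence 1 and V are
  independent.\<close>

lemma linear_norm:
  "(ev1 p0 + V * ev1 p1) * (ev1 p0 - V * ev1 p1) * ev1 vden = ev1 (p0^2 * vden - p1^2 * vnum)"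
  unfolding ev1_simps ev1_vden_V[symmetric] by (simp add: algebra_simps power2_eq_square)

lemma linear_eq_0_iff:
  "ev1 p0 + V * ev1 p1 = 0 \<longleftrightarrow> p0 = 0 \<and> p1 = 0"
proof
  assume "ev1 p0 + V * ev1 p1 = 0"
  then have "ev1 (p0^2 * vden - p1^2 * vnum) = 0" using linear_norm[of p0 p1] by simp
  then show "p0 = 0 \<and> p1 = 0" using vsq_not_square by simp
qed (simp add: poly_hom_0)

lemma ev2_eq_0_iff:
  assumes "[:vden^n:] * p = [:p0, p1:] + [:- vnum, 0, vden:] * k"
  shows "ev2 p = 0 \<longleftrightarrow> p0 = 0 \<and> p1 = 0"
  using ev2_reduce[OF assms] linear_eq_0_iff[of p0 p1] by auto

end

context edwards_curve
begin

lemma coord_u_nonconst: "coord_u \<notin> range geom_const"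
  by (auto simp: coord_u_def geom_const_def)

text \<open>The coordinate functions form the tautological generic point, whose \<open>ev2\<close>
  is \<open>geom_fun\<close>. All facts about generic points thus apply to the function field
  itself.\<close>

sublocale gen: generic_point c d geom_const coord_u "coord_v c d"
proof
  show "coord_u^2 + coord_v c d^2 = geom_const (to_ac c)^2 * (1 + geom_const (to_ac d) * coord_u^2 * coord_v c d^2)"
    using coord_v_equation[OF c, of d] by (simp add: base_const_def)
qed (use ring_hom_total_geom_const coord_u_nonconst in auto)

abbreviation K :: "'a fun_univ set" where "K \<equiv> geom_function_field c d"

lemma K_I: "geom_fun c d r \<noteq> 0 \<Longrightarrow> geom_fun c d p / geom_fun c d r \<in> K"
  by (auto simp: geom_function_field_def)

lemma geom_fun_in_K: "geom_fun c d p \<in> K"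
  using K_I[of 1 p] by (simp add: geom_fun_eq gen.ev2_simps)

lemma K_E:
  assumes "z \<in> K"
  obtains p r where "geom_fun c d r \<noteq> 0" "z = geom_fun c d p / geom_fun c d r"
  using assms by (auto simp: geom_function_field_def)

lemma K_add: "x \<in> K \<Longrightarrow> y \<in> K \<Longrightarrow> x + y \<in> K"
  by (elim K_E) (auto simp: add_frac_eq geom_fun_eq simp flip: gen.ev2_simps intro!: K_I[unfolded geom_fun_eq],
    simp add: gen.ev2_simps)

lemma K_mult: "x \<in> K \<Longrightarrow> y \<in> K \<Longrightarrow> x * y \<in> K"
  by (elim K_E) (auto simp: geom_fun_eq simp flip: gen.ev2_simps intro!: K_I[unfolded geom_fun_eq],
    simp add: gen.ev2_simps)

lemma K_inverse: "x \<in> K \<Longrightarrow> inverse x \<in> K"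
  by (metis K_E K_I divide_eq_0_iff geom_fun_in_K inverse_divide inverse_zero)

lemma K_const: "geom_const a \<in> K"
  using geom_fun_in_K[of "[:[:a:]:]"]
  by (simp add: geom_fun_eq poly_hom_const gen.ev1_simps gen.h_simps)

lemma K_1: "1 \<in> K" and K_0: "0 \<in> K"
  using K_const[of 1] K_const[of 0] by (simp_all add: gen.h_simps)

lemma K_uminus: "x \<in> K \<Longrightarrow> - x \<in> K"
  using K_mult[of "geom_const (-1)" x] K_const[of "-1"] by (simp add: gen.h_simps)

lemma K_diff: "x \<in> K \<Longrightarrow> y \<in> K \<Longrightarrow> x - y \<in> K"
  using K_add[of x "- y"] K_uminus by simp

lemma K_divide: "x \<in> K \<Longrightarrow> y \<in> K \<Longrightarrow> x / y \<in> K"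
  unfolding divide_inverse by (intro K_mult K_inverse)

lemma K_power: "x \<in> K \<Longrightarrow> x ^ n \<in> K"
  by (induction n) (auto intro: K_1 K_mult)

lemma K_u: "coord_u \<in> K"
  using geom_fun_in_K[of "[:[:0, 1:]:]"]
  by (simp add: geom_fun_eq poly_hom_const gen.ev1_simps gen.h_simps poly_hom_pCons poly_hom_0)

lemma K_v: "coord_v c d \<in> K"
  using geom_fun_in_K[of "[:0, 1:]"]
  by (simp add: geom_fun_eq gen.ev1_simps poly_hom_pCons poly_hom_0)

lemma K_base_const: "base_const a \<in> K"
  by (simp add: base_const_def K_const)

lemma K_sum: "(\<And>i. i \<in> I \<Longrightarrow> f i \<in> K) \<Longrightarrow> sum f I \<in> K"
  by (induction I rule: infinite_finite_induct) (auto intro: K_0 K_add)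

lemma base_fun_eq_geom_fun: "base_fun c d p = geom_fun c d (map_poly (map_poly to_ac) p)"
proof -
  have "poly_hom geom_const coord_u (map_poly to_ac q) = poly_hom base_const coord_u q" for q :: "'a poly"
    by (rule poly_hom_map) (simp_all add: gen.h_simps base_const_def)
  then show ?thesis
    unfolding base_fun_eq geom_fun_eq by (intro poly_hom_map[symmetric]) (simp_all add: gen.ev1_simps)
qed

lemma base_function_field_subset: "base_function_field c d \<subseteq> K"
  by (auto simp: base_function_field_def base_fun_eq_geom_fun intro!: K_I)

lemmas K_intros = K_add K_mult K_inverse K_const K_1 K_0 K_uminus K_diff K_divide K_power K_u K_v K_base_const K_sum

end

section \<open>Specialization at a generic point as a field embedding\<close>

context generic_point
begin

text \<open>The remainder p0 + p1 v modulo the curve equation does not depend on the point and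
  vanishes at a generic point only if p0 = p1 = 0. So all generic points satisfy the same polynomial
  relations.\<close>

lemma ev2_eq_0_iff_geom_fun: "ev2 p = 0 \<longleftrightarrow> geom_fun c d p = 0"
proof -
  obtain n p0 p1 k where "[:vden^n:] * p = [:p0, p1:] + [:- vnum, 0, vden:] * k"
    using curve_reduce by blast
  then show ?thesis using ev2_eq_0_iff gen.ev2_eq_0_iff geom_fun_eq by metis
qed

abbreviation "spec \<equiv> specialize c d h U V"

lemma spec_eq:
  assumes "geom_fun c d r \<noteq> 0"
  shows "spec (geom_fun c d p / geom_fun c d r) = ev2 p / ev2 r"
proof -
  let ?z = "geom_fun c d p / geom_fun c d r"
  let ?P = "\<lambda>(p, r). geom_fun c d r \<noteq> 0 \<and> ?z = geom_fun c d p / geom_fun c d r"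
  obtain p' r' where e: "Eps ?P = (p', r')" by (cases "Eps ?P")
  have "?P (Eps ?P)" by (rule someI[of ?P "(p, r)"]) (use assms in auto)
  then have r': "geom_fun c d r' \<noteq> 0" and eq: "?z = geom_fun c d p' / geom_fun c d r'"
    unfolding e by auto
  have "geom_fun c d (p * r' - p' * r) = 0"
    using r' eq assms by (simp add: geom_fun_eq gen.ev2_simps frac_eq_eq)
  then have "ev2 (p * r' - p' * r) = 0" by (simp add: ev2_eq_0_iff_geom_fun)
  moreover have "ev2 r \<noteq> 0" "ev2 r' \<noteq> 0" using assms r' by (auto simp: ev2_eq_0_iff_geom_fun)
  ultimately have "ev2 p' / ev2 r' = ev2 p / ev2 r" by (simp add: ev2_simps frac_eq_eq)
  then show ?thesis using K_I[OF assms, of p] by (simp add: specialize_def e)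
qed

lemma spec_geom_fun: "spec (geom_fun c d p) = ev2 p"
  using spec_eq[of 1 p] by (simp add: geom_fun_eq gen.ev2_simps ev2_simps)

lemma spec_add: "x \<in> K \<Longrightarrow> y \<in> K \<Longrightarrow> spec (x + y) = spec x + spec y"
proof (elim K_E)
  fix p r p' r'
  assume r: "geom_fun c d r \<noteq> 0" "geom_fun c d r' \<noteq> 0"
    and x: "x = geom_fun c d p / geom_fun c d r" and y: "y = geom_fun c d p' / geom_fun c d r'"
  have "x + y = geom_fun c d (p * r' + p' * r) / geom_fun c d (r * r')"
    using r by (simp add: x y add_frac_eq geom_fun_eq gen.ev2_simps)
  moreover have "geom_fun c d (r * r') \<noteq> 0" using r by (simp add: geom_fun_eq gen.ev2_simps)
  moreover have "ev2 r \<noteq> 0" "ev2 r' \<noteq> 0" using r by (auto simp: ev2_eq_0_iff_geom_fun)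
  ultimately show ?thesis using r by (simp add: spec_eq ev2_simps x y add_frac_eq)
qed

lemma spec_mult: "x \<in> K \<Longrightarrow> y \<in> K \<Longrightarrow> spec (x * y) = spec x * spec y"
proof (elim K_E)
  fix p r p' r'
  assume r: "geom_fun c d r \<noteq> 0" "geom_fun c d r' \<noteq> 0"
    and x: "x = geom_fun c d p / geom_fun c d r" and y: "y = geom_fun c d p' / geom_fun c d r'"
  have "x * y = geom_fun c d (p * p') / geom_fun c d (r * r')"
    using r by (simp add: x y geom_fun_eq gen.ev2_simps)
  moreover have "geom_fun c d (r * r') \<noteq> 0" using r by (simp add: geom_fun_eq gen.ev2_simps)
  ultimately show ?thesis using r by (simp add: spec_eq ev2_simps x y)
qed

lemma spec_const: "spec (geom_const a) = h a"
  using spec_geom_fun[of "[:[:a:]:]"]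
  by (simp add: geom_fun_eq poly_hom_const gen.ev1_simps gen.h_simps h_simps ev1_simps)

lemma spec_0: "spec 0 = 0" and spec_1: "spec 1 = 1"
  using spec_const[of 0] spec_const[of 1] by (simp_all add: gen.h_simps h_simps)

lemma spec_base_const: "spec (base_const a) = h (to_ac a)"
  by (simp add: base_const_def spec_const)

lemma spec_u: "spec coord_u = U"
  using spec_geom_fun[of "[:[:0, 1:]:]"]
  by (simp add: geom_fun_eq poly_hom_const gen.ev1_simps gen.h_simps h_simps ev1_simps poly_hom_pCons poly_hom_0)

lemma spec_v: "spec (coord_v c d) = V"
  using spec_geom_fun[of "[:0, 1:]"]
  by (simp add: geom_fun_eq gen.ev1_simps ev1_simps poly_hom_pCons poly_hom_0)

lemma spec_uminus: "x \<in> K \<Longrightarrow> spec (- x) = - spec x"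
  using spec_mult[of "geom_const (-1)" x] K_const[of "-1"] spec_const[of "-1"]
  by (simp add: gen.h_simps h_simps)

lemma spec_diff: "x \<in> K \<Longrightarrow> y \<in> K \<Longrightarrow> spec (x - y) = spec x - spec y"
  using spec_add[of x "- y"] by (simp add: spec_uminus K_intros)

lemma spec_inverse: "x \<in> K \<Longrightarrow> spec (inverse x) = inverse (spec x)"
proof (cases "x = 0")
  case False
  assume "x \<in> K"
  then have "spec (inverse x) * spec x = 1"
    using False by (simp flip: spec_mult add: K_intros spec_1)
  then show ?thesis by (metis inverse_unique mult.commute)
qed (simp add: spec_0)

lemma spec_divide: "x \<in> K \<Longrightarrow> y \<in> K \<Longrightarrow> spec (x / y) = spec x / spec y"
  by (simp add: divide_inverse spec_mult spec_inverse K_intros)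

lemma spec_sum: "(\<And>i. i \<in> I \<Longrightarrow> f i \<in> K) \<Longrightarrow> spec (sum f I) = (\<Sum>i\<in>I. spec (f i))"
  by (induction I rule: infinite_finite_induct) (simp_all add: spec_0 spec_add K_sum)

lemma spec_eq_0_iff: "x \<in> K \<Longrightarrow> spec x = 0 \<longleftrightarrow> x = 0"
proof
  assume x: "x \<in> K" "spec x = 0"
  show "x = 0"
  proof (rule ccontr)
    assume "x \<noteq> 0"
    then show False using x spec_mult[of x "inverse x"] by (simp add: K_intros spec_1)
  qed
qed (simp add: spec_0)

lemma spec_outside: "x \<notin> K \<Longrightarrow> spec x = 0"
  by (simp add: specialize_def)

lemma spec_poly_hom:
  assumes "x \<in> K"
  shows "poly_hom geom_const x p \<in> K \<and> spec (poly_hom geom_const x p) = poly_hom h (spec x) p"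
  by (induction p) (auto simp: assms poly_hom_0 poly_hom_pCons gen.h_simps h_simps spec_0 spec_add spec_mult spec_const K_intros)

lemma spec_poly_hom2:
  assumes "x \<in> K" "y \<in> K"
  shows "poly_hom (poly_hom geom_const x) y p \<in> K \<and>
    spec (poly_hom (poly_hom geom_const x) y p) = poly_hom (poly_hom h (spec x)) (spec y) p"
  by (induction p) (auto simp: assms poly_hom_0 poly_hom_pCons[of "poly_hom _ _"] spec_0 spec_add spec_mult
    spec_poly_hom[OF assms(1)] K_intros)

end

section \<open>Translations and places\<close>

context edwards_curve
begin

lemmas base_const_simps = ring_hom_total_simps[OF ring_hom_total_base_const]

lemma base_const_eq_0_iff [simp]: "base_const a = 0 \<longleftrightarrow> a = 0"
  by (simp add: base_const_def geom_const_def)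

lemma base_const_eq_iff [simp]: "base_const a = base_const b \<longleftrightarrow> a = b"
  using base_const_eq_0_iff[of "a - b"] by (simp add: base_const_simps)

lemma base_const_divide: "base_const (a / b) = base_const a / base_const b"
proof (cases "b = 0")
  case False
  then have "base_const (a / b) * base_const b = base_const a" by (simp flip: base_const_simps)
  then show ?thesis using False by (simp add: eq_divide_eq)
qed (simp add: base_const_simps)

abbreviation base_point :: "'a \<times> 'a \<Rightarrow> 'a fun_univ \<times> 'a fun_univ" where
  "base_point \<equiv> map_prod base_const base_const"

abbreviation coord_point :: "'a fun_univ \<times> 'a fun_univ" where
  "coord_point \<equiv> (coord_u, coord_v c d)"

text \<open>The generic point plus the constant point H. Substituting it in a function z gives P
  \<mapsto> z(P + H), which is \<open>trans H z\<close>.\<close>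

definition shift :: "'a \<times> 'a \<Rightarrow> 'a fun_univ \<times> 'a fun_univ" where
  "shift H = edwards_add (base_const c) (base_const d) coord_point (base_point H)"

definition trans :: "'a \<times> 'a \<Rightarrow> 'a fun_univ \<Rightarrow> 'a fun_univ" where
  "trans H = specialize c d geom_const (fst (shift H)) (snd (shift H))"

lemma coord_point_on: "coord_point \<in> edwards_points (base_const c) (base_const d)"
  using coord_v_equation[OF c] by (simp add: edwards_points_def)

lemma base_point_on:
  assumes "H \<in> edwards_points c d"
  shows "base_point H \<in> edwards_points (base_const c) (base_const d)"
proof (cases H)
  case (Pair a b)
  then have "base_const (a^2 + b^2) = base_const (c^2 * (1 + d*a^2*b^2))"
    using assms by (simp add: edwards_points_def)
  then show ?thesis by (simp add: Pair edwards_points_def base_const_simps)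
qed

text \<open>A relation here would be linear in v over k(u) with constant term 1. These are the
  denominators of generic point plus rational point, to which \<open>edwards_complete\<close> does
  not apply.\<close>

lemma one_plus_uv_nonzero: "1 + coord_u * coord_v c d * base_const e \<noteq> 0"
proof -
  have "poly_hom geom_const coord_u [:1:] + coord_v c d * poly_hom geom_const coord_u [:0, to_ac e:] \<noteq> 0"
    unfolding gen.linear_eq_0_iff by simp
  then show ?thesis
    by (simp add: poly_hom_pCons poly_hom_0 gen.h_simps base_const_def mult_ac)
qed

lemma coord_regular: "edwards_regular (base_const d) coord_point (base_point H)"
proof -
  obtain a b where H: "H = (a, b)" by (cases H)
  show ?thesis
    using one_plus_uv_nonzero[of "d*a*b"] one_plus_uv_nonzero[of "- (d*a*b)"]
    by (simp add: H edwards_regular_def base_const_simps mult_ac)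
qed

lemma shift_eq:
  "shift (a, b) =
    ((coord_u * base_const b + base_const a * coord_v c d) /
      (base_const c * (1 + coord_u * coord_v c d * base_const (d * a * b))),
     (coord_v c d * base_const b - coord_u * base_const a) /
      (base_const c * (1 + coord_u * coord_v c d * base_const (- (d * a * b)))))"
  by (simp add: shift_def edwards_add_def base_const_simps mult_ac)

lemma shift_in_K: "fst (shift H) \<in> K" "snd (shift H) \<in> K"
  by (cases H; simp add: shift_eq K_intros)+

lemma shift_on:
  "H \<in> edwards_points c d \<Longrightarrow> shift H \<in> edwards_points (base_const c) (base_const d)"
  unfolding shift_def using c
  by (intro edwards_add_closed coord_point_on base_point_on coord_regular) simp_all

text \<open>Clearing the denominator in a constant first coordinate gives a linear relation between
  1 and v over k(u). Its coefficients force a = b = 0, but the origin is not on the curve.\<close>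

lemma shift_nonconst:
  assumes "H \<in> edwards_points c d"
  shows "fst (shift H) \<notin> range geom_const"
proof
  assume "fst (shift H) \<in> range geom_const"
  then obtain e where e: "fst (shift H) = geom_const e" by blast
  obtain a b where H: "H = (a, b)" by (cases H)
  have "coord_u * base_const b + base_const a * coord_v c d =
      geom_const e * (base_const c * (1 + coord_u * coord_v c d * base_const (d * a * b)))"
    using e c one_plus_uv_nonzero by (simp add: H shift_eq divide_eq_eq)
  then have "poly_hom geom_const coord_u [:- e * to_ac c, to_ac b:] +
      coord_v c d * poly_hom geom_const coord_u [:to_ac a, - (e * to_ac c * to_ac (d*a*b)):] = 0"
    by (simp add: poly_hom_pCons poly_hom_0 gen.h_simps base_const_def algebra_simps del: to_ac_mult)
  then have "a = 0" "b = 0" unfolding gen.linear_eq_0_iff by simp_all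
  then show False using assms c by (simp add: H edwards_points_def)
qed

lemma generic_shift:
  assumes "H \<in> edwards_points c d"
  shows "generic_point c d geom_const (fst (shift H)) (snd (shift H))"
proof unfold_locales
  show "fst (shift H)^2 + snd (shift H)^2 =
    geom_const (to_ac c)^2 * (1 + geom_const (to_ac d) * fst (shift H)^2 * snd (shift H)^2)"
    using shift_on[OF assms] by (cases "shift H") (simp add: edwards_points_def base_const_def)
qed (use assms ring_hom_total_geom_const shift_nonconst in auto)

lemma base_point_add: "base_point (edwards_add c d G H) =
    edwards_add (base_const c) (base_const d) (base_point G) (base_point H)"
  by (cases G; cases H) (simp add: edwards_add_def base_const_divide base_const_simps)

lemma shift_shift:
  assumes G: "G \<in> edwards_points c d" and H: "H \<in> edwards_points c d"
  shows "(trans G (fst (shift H)), trans G (snd (shift H))) = shift (edwards_add c d G H)"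
proof -
  interpret G: generic_point c d geom_const "fst (shift G)" "snd (shift G)"
    by (rule generic_shift[OF G])
  obtain a b where ab: "H = (a, b)" by (cases H)
  let ?e = "base_const (d * a * b)"
  have base: "G.spec (base_const e) = base_const e" for e
    using G.spec_base_const[of e] by (simp only: base_const_def)
  \<comment> \<open>The denominators for adding H to the shifted point are images of nonzero
    functions under the embedding \<open>trans G\<close>. This supplies the regularity that
    associativity asks for.\<close>
  have nz: "trans G (1 + coord_u * coord_v c d * base_const e) \<noteq> 0" for e
    unfolding trans_def by (subst G.spec_eq_0_iff) (simp_all add: one_plus_uv_nonzero K_intros)
  have t: "trans G (1 + coord_u * coord_v c d * base_const e) =
      1 + fst (shift G) * snd (shift G) * base_const e" for e
    unfolding trans_def
    by (simp add: G.spec_add G.spec_mult G.spec_1 G.spec_u G.spec_v base K_intros)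
  have "(trans G (fst (shift H)), trans G (snd (shift H))) =
      edwards_add (base_const c) (base_const d) (shift G) (base_point H)"
    unfolding ab shift_eq trans_def fst_conv snd_conv
    by (simp add: G.spec_divide G.spec_diff G.spec_add G.spec_mult G.spec_1 G.spec_u G.spec_v base K_intros
      edwards_add_def case_prod_beta) (simp add: base_const_simps mult_ac)
  also have "\<dots> = edwards_add (base_const c) (base_const d) coord_point
      (edwards_add (base_const c) (base_const d) (base_point G) (base_point H))"
    unfolding shift_def
  proof (rule edwards_add_assoc)
    show "edwards_regular (base_const d) (base_point G) (base_point H)"
    proof -
      have "base_const (1 + d * fst G * fst H * snd G * snd H) \<noteq> 0"
        "base_const (1 - d * fst G * fst H * snd G * snd H) \<noteq> 0"
        using edwards_complete[OF G H] by (simp_all add: edwards_regular_def)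
      then show ?thesis unfolding edwards_regular_def by (simp add: base_const_simps)
    qed
    show "edwards_regular (base_const d)
      (edwards_add (base_const c) (base_const d) coord_point (base_point G)) (base_point H)"
      using nz[of "d*a*b"] nz[of "- (d*a*b)"] unfolding t shift_def[symmetric]
      by (simp add: edwards_regular_def ab base_const_simps mult_ac)
  qed (use c in \<open>simp_all add: coord_point_on base_point_on G H coord_regular flip: base_point_add\<close>)
  finally show ?thesis by (simp add: shift_def base_point_add)
qed

lemma trans_in_K: "H \<in> edwards_points c d \<Longrightarrow> z \<in> K \<Longrightarrow> trans H z \<in> K"
proof -
  assume H: "H \<in> edwards_points c d" and z: "z \<in> K"
  interpret H: generic_point c d geom_const "fst (shift H)" "snd (shift H)"
    by (rule generic_shift[OF H])
  obtain p r where "geom_fun c d r \<noteq> 0" "z = geom_fun c d p / geom_fun c d r" using z by (rule K_E)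
  then show ?thesis
    unfolding trans_def using gen.spec_poly_hom2[OF shift_in_K] by (simp add: H.spec_eq K_intros)
qed

lemma trans_trans:
  assumes G: "G \<in> edwards_points c d" and H: "H \<in> edwards_points c d" and z: "z \<in> K"
  shows "trans G (trans H z) = trans (edwards_add c d G H) z"
proof -
  interpret G: generic_point c d geom_const "fst (shift G)" "snd (shift G)"
    by (rule generic_shift[OF G])
  interpret H: generic_point c d geom_const "fst (shift H)" "snd (shift H)"
    by (rule generic_shift[OF H])
  let ?GH = "edwards_add c d G H"
  interpret GH: generic_point c d geom_const "fst (shift ?GH)" "snd (shift ?GH)"
    by (rule generic_shift[OF add_closed[OF G H]])
  obtain p r where z: "geom_fun c d r \<noteq> 0" "z = geom_fun c d p / geom_fun c d r" using z by (rule K_E)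
  have "fst (shift ?GH) = G.spec (fst (shift H))" "snd (shift ?GH) = G.spec (snd (shift H))"
    using shift_shift[OF G H] unfolding trans_def by (metis fst_conv, metis snd_conv)
  then have "G.spec (H.ev2 q) = GH.ev2 q" "H.ev2 q \<in> K" for q
    using G.spec_poly_hom2[OF shift_in_K[of H]] by auto
  then show ?thesis
    unfolding trans_def z(2) H.spec_eq[OF z(1)] GH.spec_eq[OF z(1)] by (simp add: G.spec_divide)
qed

lemma trans_zero: "z \<in> K \<Longrightarrow> trans (0, c) z = z"
proof -
  assume "z \<in> K"
  then obtain p r where z: "geom_fun c d r \<noteq> 0" "z = geom_fun c d p / geom_fun c d r" by (rule K_E)
  have "shift (0, c) = coord_point" using c by (simp add: shift_eq base_const_simps)
  then show ?thesis unfolding z(2) trans_def using gen.spec_eq[OF z(1)] by (simp add: geom_fun_eq)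
qed

lemma exists_inverse:
  assumes "H \<in> edwards_points c d"
  obtains H' where "H' \<in> edwards_points c d" "edwards_add c d H H' = (0, c)" "edwards_add c d H' H = (0, c)"
proof -
  interpret comm_group "edwards_group c d" by (rule edwards_group_comm_group)
  have "H \<in> carrier (edwards_group c d)" using assms by (simp add: edwards_group_def)
  from inv_closed[OF this] r_inv[OF this] l_inv[OF this] show ?thesis
    by (intro that[of "inv\<^bsub>edwards_group c d\<^esub> H"]) (simp_all add: edwards_group_def)
qed

lemma trans_surj:
  assumes "H \<in> edwards_points c d" "z \<in> K"
  obtains y where "y \<in> K" "trans H y = z"
  by (metis assms exists_inverse trans_in_K trans_trans trans_zero)

section \<open>Places under translation\<close>

lemma placesD:
  assumes "ord \<in> places c d"
  shows "z \<notin> K \<Longrightarrow> ord z = 0" "ord 0 = 0"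
    "x \<in> K \<Longrightarrow> x \<noteq> 0 \<Longrightarrow> y \<in> K \<Longrightarrow> y \<noteq> 0 \<Longrightarrow> ord (x * y) = ord x + ord y"
    "x \<in> K \<Longrightarrow> x \<noteq> 0 \<Longrightarrow> y \<in> K \<Longrightarrow> y \<noteq> 0 \<Longrightarrow> x + y \<noteq> 0 \<Longrightarrow> min (ord x) (ord y) \<le> ord (x + y)"
    "ord (geom_const a) = 0" "\<exists>z \<in> K. ord z = 1"
  using assms by (auto simp: places_def)

text \<open>Translation is an automorphism over the constants; its surjectivity provides an element
  of order 1.\<close>

lemma place_trans:
  assumes H: "H \<in> edwards_points c d" and "ord \<in> places c d"
  shows "(\<lambda>z. ord (trans H z)) \<in> places c d"
proof -
  interpret H: generic_point c d geom_const "fst (shift H)" "snd (shift H)"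
    by (rule generic_shift[OF H])
  note p = placesD[OF assms(2)]
  have s: "H.spec z \<in> K" if "z \<in> K" for z using trans_in_K[OF H that] by (simp add: trans_def)
  obtain z where "z \<in> K" "ord z = 1" using p(6) by blast
  then have "\<exists>z\<in>K. ord (H.spec z) = 1" using trans_surj[OF H] unfolding trans_def by metis
  then show ?thesis
    unfolding places_def trans_def
  proof (intro CollectI conjI allI impI ballI)
    fix z assume "z \<notin> K - {0}"
    then show "ord (H.spec z) = 0" by (auto simp: H.spec_outside H.spec_0 p(2))
  next
    fix x y assume xy: "x \<in> K - {0}" "y \<in> K - {0}"
    then show "ord (H.spec (x * y)) = ord (H.spec x) + ord (H.spec y)"
      by (simp add: H.spec_mult p(3) s H.spec_eq_0_iff)
    assume "x + y \<noteq> 0"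
    then have "H.spec x + H.spec y \<noteq> 0"
      using xy H.spec_eq_0_iff[of "x + y"] by (simp add: H.spec_add K_add)
    then show "min (ord (H.spec x)) (ord (H.spec y)) \<le> ord (H.spec (x + y))"
      using xy p(4)[of "H.spec x" "H.spec y"] by (simp add: H.spec_add s H.spec_eq_0_iff)
  qed (simp_all add: H.spec_const p)
qed

lemma place_trans_inj:
  assumes H: "H \<in> edwards_points c d" and "ord \<in> places c d" "ord' \<in> places c d"
    and eq: "\<And>z. z \<in> K \<Longrightarrow> ord (trans H z) = ord' (trans H z)"
  shows "ord = ord'"
proof
  fix z
  show "ord z = ord' z"
    using trans_surj[OF H, of z] eq placesD(1)[OF assms(2), of z] placesD(1)[OF assms(3), of z] by metis
qed

text \<open>The value \<open>0\<close> of a place at \<open>0\<close> is a junk value, so inequalities treat \<open>0\<close> separately.\<close>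

definition ord_ge :: "('a fun_univ \<Rightarrow> int) \<Rightarrow> int \<Rightarrow> 'a fun_univ \<Rightarrow> bool" where
  "ord_ge ord n z \<longleftrightarrow> z \<in> K \<and> (z = 0 \<or> n \<le> ord z)"

context
  fixes ord assumes place: "ord \<in> places c d"
begin

lemmas pl = placesD[OF place]

lemma ord_const: "ord (base_const a) = 0" "ord 1 = 0" "ord (- 1) = 0"
  using pl(5)[of "to_ac a"] pl(5)[of 1] pl(5)[of "- 1"] by (simp_all add: base_const_def gen.h_simps)

lemma ord_power: "x \<in> K \<Longrightarrow> x \<noteq> 0 \<Longrightarrow> ord (x ^ n) = int n * ord x"
  by (induction n) (simp_all add: ord_const pl(3) K_intros algebra_simps)

lemma ord_inverse: "x \<in> K \<Longrightarrow> x \<noteq> 0 \<Longrightarrow> ord (inverse x) = - ord x"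
  using pl(3)[of x "inverse x"] by (simp add: K_intros ord_const)

lemma ord_divide: "x \<in> K \<Longrightarrow> x \<noteq> 0 \<Longrightarrow> y \<in> K \<Longrightarrow> y \<noteq> 0 \<Longrightarrow> ord (x / y) = ord x - ord y"
  by (simp add: divide_inverse pl(3) K_intros ord_inverse)

lemma ord_uminus: "ord (- x) = ord x"
proof (cases "x \<in> K \<and> x \<noteq> 0")
  case True
  then show ?thesis using pl(3)[of "- 1" x] by (simp add: ord_const K_intros)
next
  case False
  then have "- x \<notin> K \<or> x = 0" using K_uminus[of "- x"] by auto
  then show ?thesis using False pl(1,2) by auto
qed

lemma ord_geD: "ord_ge ord n x \<Longrightarrow> x \<noteq> 0 \<Longrightarrow> n \<le> ord x"
  by (auto simp: ord_ge_def)

lemma ord_geI: "x \<in> K \<Longrightarrow> n \<le> ord x \<Longrightarrow> ord_ge ord n x"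
  by (auto simp: ord_ge_def)

lemma ord_ge_0: "ord_ge ord n 0"
  by (simp add: ord_ge_def K_0)

lemma ord_ge_mono: "ord_ge ord n x \<Longrightarrow> m \<le> n \<Longrightarrow> ord_ge ord m x"
  by (auto simp: ord_ge_def)

lemma ord_ge_add: "ord_ge ord n x \<Longrightarrow> ord_ge ord n y \<Longrightarrow> ord_ge ord n (x + y)"
  using pl(4)[of x y] by (cases "x = 0 \<or> y = 0 \<or> x + y = 0") (auto simp: ord_ge_def K_intros)

lemma ord_ge_uminus: "ord_ge ord n x \<Longrightarrow> ord_ge ord n (- x)"
  by (auto simp: ord_ge_def K_intros ord_uminus)

lemma ord_ge_diff: "ord_ge ord n x \<Longrightarrow> ord_ge ord n y \<Longrightarrow> ord_ge ord n (x - y)"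
  using ord_ge_add[of n x "- y"] ord_ge_uminus[of n y] by simp

lemma ord_ge_mult: "ord_ge ord n x \<Longrightarrow> ord_ge ord m y \<Longrightarrow> ord_ge ord (n + m) (x * y)"
  using pl(3)[of x y] by (cases "x = 0 \<or> y = 0") (auto simp: ord_ge_def K_intros)

lemma ord_ge_const: "ord_ge ord 0 (base_const a)"
  by (simp add: ord_ge_def ord_const K_intros)

lemma ord_ge_const_mult: "ord_ge ord n x \<Longrightarrow> ord_ge ord n (base_const a * x)"
  using ord_ge_mult[OF ord_ge_const, of n x a] by simp

lemma ord_ge_sum: "(\<And>i. i \<in> I \<Longrightarrow> ord_ge ord n (f i)) \<Longrightarrow> ord_ge ord n (sum f I)"
  by (induction I rule: infinite_finite_induct) (simp_all add: ord_ge_0 ord_ge_add)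

lemma ord_add_eq:
  assumes x: "x \<in> K" "x \<noteq> 0" and y: "ord_ge ord (ord x + 1) y"
  shows "ord (x + y) = ord x" "x + y \<noteq> 0"
proof -
  show nz: "x + y \<noteq> 0"
  proof
    assume "x + y = 0"
    then have "y = - x" by (simp add: eq_neg_iff_add_eq_0 add.commute)
    then show False using x y by (simp add: ord_ge_def ord_uminus)
  qed
  have "ord_ge ord (ord x) (x + y)"
    using x ord_ge_mono[OF y, of "ord x"] by (intro ord_ge_add) (auto intro: ord_geI)
  then have 1: "ord x \<le> ord (x + y)" using nz by (rule ord_geD)
  have "ord (x + y) \<le> ord x"
  proof (rule ccontr)
    assume "\<not> ?thesis"
    then have "ord_ge ord (ord x + 1) (x + y)"
      using x y by (intro ord_geI) (auto simp: ord_ge_def K_intros)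
    then have "ord_ge ord (ord x + 1) (x + y - y)" using y by (rule ord_ge_diff)
    then show False using x by (simp add: ord_ge_def)
  qed
  with 1 show "ord (x + y) = ord x" by simp
qed

text \<open>At infinity, one coordinate \<open>x\<close> has a pole and the other, \<open>y\<close>, satisfies \<open>y\<^sup>2 = 1 / (c\<^sup>2 d)\<close>.
  The translation by an affine point other than the four with a vanishing coordinate moves
  the place to an affine one.\<close>

context
  fixes x y
  assumes xy: "x \<in> K" "y \<in> K" "x \<noteq> 0" "y \<noteq> 0"
    and curve: "x^2 + y^2 = base_const c^2 * (1 + base_const d * x^2 * y^2)"
    and pole: "ord x < 0"
begin

text \<open>D is the denominator of y^2 = (c^2 - x^2) / D; where x has a pole, numerator and
  denominator both have the order of x^2.\<close>

lemma den_infinity: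
  defines "D \<equiv> 1 - base_const (c^2 * d) * x^2"
  shows "D \<in> K" "D \<noteq> 0" "ord D = 2 * ord x" "y^2 * D = base_const (c^2) - x^2"
proof -
  have e: "D = - base_const (c^2*d) * x^2 + 1" by (simp add: D_def)
  have o: "ord (- base_const (c^2*d) * x^2) = 2 * ord x"
    using xy c d by (simp add: pl(3) ord_uminus ord_const ord_power K_intros)
  have 1: "- base_const (c^2*d) * x^2 \<in> K" "- base_const (c^2*d) * x^2 \<noteq> 0"
    using xy c d by (auto intro!: K_intros)
  have 2: "ord_ge ord (ord (- base_const (c^2*d) * x^2) + 1) 1"
    using pole by (intro ord_geI) (simp_all only: o ord_const K_1)
  show "D \<in> K" using xy by (simp add: D_def K_intros)
  show "D \<noteq> 0" "ord D = 2 * ord x" unfolding e using ord_add_eq[OF 1 2] o by simp_all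
  show "y^2 * D = base_const (c^2) - x^2"
    using curve by (simp add: D_def base_const_simps algebra_simps)
qed

lemma ord_y: "ord y = 0"
proof -
  note D = den_infinity
  have 2: "ord_ge ord (ord (- (x^2)) + 1) (base_const (c^2))"
    using pole xy by (intro ord_geI) (simp_all add: ord_uminus ord_const ord_power K_intros)
  have "ord (- (x^2) + base_const (c^2)) = 2 * ord x"
    using ord_add_eq(1)[OF _ _ 2] xy by (simp add: ord_uminus ord_power K_intros)
  then have "ord (y^2 * (1 - base_const (c^2 * d) * x^2)) = 2 * ord x" using D(4) by simp
  moreover have "ord (y^2 * (1 - base_const (c^2 * d) * x^2)) = ord (y^2) + 2 * ord x"
    using pl(3)[of "y^2" "1 - base_const (c^2 * d) * x^2"] D xy by (simp add: K_power)
  ultimately have "ord (y^2) = 0" by simp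
  then show ?thesis using xy by (simp add: ord_power)
qed

text \<open>For a \<noteq> 0 the order of \<open>T x\<close> is nonnegative. If b = 0, then
  \<open>T x\<close> is a constant times the unit y; otherwise its denominator has the order of x
  and its numerator, if nonzero, at least that order. An arbitrary \<open>T\<close> allows both
  orders of the coordinates, with -a for a when they are exchanged.\<close>

lemma translate_infinity:
  assumes T: "\<And>z. z \<in> K \<Longrightarrow> ord (T z) = ord z"
    and Tx: "T x = (base_const b * x + base_const a * y) / (base_const c * (1 + base_const (d * a * b) * (x * y)))"
    and ab: "(a, b) \<in> edwards_points c d"
  shows "a = 0"
proof (rule ccontr)
  assume a: "a \<noteq> 0"
  show False
  proof (cases "b = 0")
    case True
    then have "T x = base_const (a / c) * y" using c by (simp add: Tx base_const_simps base_const_divide)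
    then have "ord (T x) = 0" using xy a c ord_y by (simp add: pl(3) ord_const K_intros)
    then show False using T[of x] xy pole by simp
  next
    case False
    let ?e = "base_const (d * a * b) * (x * y)"
    have nz: "d * a * b \<noteq> 0" using a d False by simp
    have bnz: "base_const (d * a * b) \<noteq> 0" using nz by (simp only: base_const_eq_0_iff not_False_eq_True)
    have "ord ?e = ord (x * y)"
      using pl(3)[of "base_const (d * a * b)" "x * y"] bnz xy by (simp add: ord_const K_intros)
    then have e: "?e \<in> K" "?e \<noteq> 0" "ord ?e = ord x"
      using xy bnz ord_y by (simp_all add: K_intros pl(3))
    have "ord_ge ord (ord ?e + 1) 1" using pole by (intro ord_geI) (simp_all only: e ord_const K_1)
    from ord_add_eq[OF e(1,2) this] have e1: "ord (1 + ?e) = ord x" "1 + ?e \<noteq> 0"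
      using e by (simp_all add: add.commute)
    let ?n = "base_const b * x + base_const a * y"
    have n: "ord_ge ord (ord x) ?n"
      using xy ord_y pole by (intro ord_ge_add ord_ge_const_mult ord_geI) simp_all
    have "ord (T x) = ord x" using T xy by simp
    moreover have "ord (T x) \<ge> 0"
    proof (cases "?n = 0")
      case False
      have "ord (base_const c * (1 + ?e)) = ord x" "base_const c * (1 + ?e) \<in> K" "base_const c * (1 + ?e) \<noteq> 0"
        using e e1 c by (simp_all add: pl(3) ord_const K_intros)
      moreover have "?n \<in> K" using xy by (simp add: K_intros)
      moreover have "ord x \<le> ord ?n" using n False by (rule ord_geD)
      ultimately show ?thesis unfolding Tx using False by (simp add: ord_divide)
    qed (simp add: Tx pl)
    ultimately show False using pole by simp
  qed
qed

text \<open>Here \<open>T\<close> negates y, as translation by (0, -c) does. With e^2 = 1 / (c^2 d),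
  the product (y - e)(y + e) is a nonzero constant divided by D, so it has positive order. If
  \<open>T\<close> fixed the place, both factors would have the same, hence positive, order, and so
  would vanish their difference 2 e, a nonzero constant.\<close>

lemma negate_infinity:
  assumes T: "\<And>z. z \<in> K \<Longrightarrow> ord (T z) = ord z"
    and Ty: "\<And>e. T (y - geom_const e) = - y - geom_const e"
  shows False
proof -
  note D = den_infinity
  let ?D = "1 - base_const (c^2 * d) * x^2"
  obtain e where e: "e^2 = 1 / to_ac (c^2 * d)" using nth_root_exists[of 2 "1 / to_ac (c^2 * d)"] by auto
  then have "e^2 * to_ac (c^2 * d) = 1" using c d by simp
  then have "geom_const (e^2 * to_ac (c^2 * d)) = geom_const 1" by (simp only:)
  then have e2: "geom_const e^2 * base_const (c^2*d) = 1" by (simp add: gen.h_simps base_const_def)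
  have "(y - geom_const e) * (y + geom_const e) * ?D * base_const (c^2 * d) =
      base_const (c^2*d) * (y^2 * ?D) - ?D * (geom_const e^2 * base_const (c^2*d))"
    by (simp add: algebra_simps power2_eq_square)
  also have "\<dots> = base_const (c^4 * d - 1)"
    unfolding D(4) e2 by (simp add: base_const_simps algebra_simps power2_eq_square power4_eq_xxxx)
  finally have eq: "(y - geom_const e) * (y + geom_const e) * ?D * base_const (c^2 * d) = base_const (c^4 * d - 1)" .
  have "(y - geom_const e) * (y + geom_const e) * ?D * base_const (c^2 * d) \<noteq> 0"
    unfolding eq using c4d by simp
  then have nz: "y - geom_const e \<noteq> 0" "y + geom_const e \<noteq> 0" by auto
  have "ord ((y - geom_const e) * (y + geom_const e) * ?D * base_const (c^2 * d)) =
      ord (y - geom_const e) + ord (y + geom_const e) + 2 * ord x"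
    using nz D c d xy by (simp add: pl(3) ord_const K_intros)
  then have sum: "ord (y - geom_const e) + ord (y + geom_const e) + 2 * ord x = 0"
    unfolding eq ord_const by simp
  have "ord (- y - geom_const e) = ord (y - geom_const e)" using T[of "y - geom_const e"] Ty xy by (simp add: K_intros)
  then have "ord (y + geom_const e) = ord (y - geom_const e)" using ord_uminus[of "y + geom_const e"] by simp
  then have pos: "1 \<le> ord (y + geom_const e)" "1 \<le> ord (y - geom_const e)" using sum pole by simp_all
  have "ord_ge ord 1 (y + geom_const e - (y - geom_const e))"
    using pos xy by (intro ord_ge_diff ord_geI) (simp_all add: K_intros)
  moreover have "y + geom_const e - (y - geom_const e) = geom_const (2 * e)" by (simp only: mult_2 gen.h_simps) (simp add: algebra_simps)
  moreover have "ord (geom_const (2 * e)) = 0" by (rule pl)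
  ultimately have "geom_const (2 * e) = 0" by (simp add: ord_ge_def)
  then have "e = 0" using two_ac by (simp add: geom_const_def)
  then show False using e2 by (simp add: gen.h_simps)
qed

end

end

end

section \<open>Laurent series\<close>

text \<open>In coefficient n + 1 of S^2 = W the unknown s_(n+1) occurs only as 2 r s_(n+1), where r
  = s_0.\<close>

fun fps_sqrt_coeff :: "'k::field fps \<Rightarrow> 'k \<Rightarrow> nat \<Rightarrow> 'k" where
  "fps_sqrt_coeff W r 0 = r"
| "fps_sqrt_coeff W r (Suc n) =
     (W $ Suc n - (\<Sum>i\<in>{1..n}. fps_sqrt_coeff W r i * fps_sqrt_coeff W r (Suc n - i))) / (2 * r)"

lemma fps_has_sqrt:
  fixes W :: "'k::field fps"
  assumes two: "(2::'k) \<noteq> 0" and r: "r^2 = W $ 0" "r \<noteq> 0"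
  shows "\<exists>S. S^2 = W"
proof (rule exI[of _ "Abs_fps (fps_sqrt_coeff W r)"], rule fps_ext)
  fix n
  let ?s = "fps_sqrt_coeff W r"
  show "(Abs_fps ?s ^ 2) $ n = W $ n"
  proof (cases n)
    case 0
    then show ?thesis using r by (simp add: power2_eq_square)
  next
    case (Suc m)
    have "{0..Suc m} = insert 0 (insert (Suc m) {1..m})" by auto
    then have "(Abs_fps ?s ^ 2) $ n = ?s 0 * ?s (Suc m) + (?s (Suc m) * ?s 0 + (\<Sum>i\<in>{1..m}. ?s i * ?s (Suc m - i)))"
      unfolding Suc by (simp add: power2_eq_square fps_mult_nth del: fps_sqrt_coeff.simps(2))
    also have "\<dots> = W $ n" using two r by (simp add: Suc field_simps)
    finally show ?thesis .
  qed
qed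

lemma fls_has_sqrt:
  fixes W :: "'k::alg_closed_field fls"
  assumes two: "(2::'k) \<noteq> 0" and W: "even (fls_subdegree W)"
  shows "\<exists>S. S^2 = W"
proof (cases "W = 0")
  case False
  define F where "F = fls_base_factor_to_fps W"
  have F0: "F $ 0 \<noteq> 0" using False by (simp add: F_def)
  obtain r where r: "r^2 = F $ 0" using nth_root_exists[of 2 "F $ 0"] by auto
  then have "r \<noteq> 0" using F0 by auto
  then obtain S where S: "S^2 = F" using fps_has_sqrt[OF two r] by blast
  obtain m where m: "fls_subdegree W = 2 * m" using W by (elim evenE)
  have "W = fls_X_intpow (fls_subdegree W) * fps_to_fls F"
    using fls_conv_base_factor_to_fps_shift_subdegree[of W] by (simp add: F_def fls_X_intpow_times_conv_shift)
  also have "\<dots> = (fls_X_intpow m * fps_to_fls S)^2"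
    unfolding S[symmetric] m by (simp add: power_mult_distrib fps_to_fls_power fls_X_intpow_power)
  finally show ?thesis by metis
qed (rule exI[of _ 0], simp)

text \<open>A relation, so that it asserts regularity at X = 0 together with the value
  there.\<close>

definition fls_at :: "'k::field fls \<Rightarrow> 'k \<Rightarrow> bool" where
  "fls_at z y \<longleftrightarrow> (\<exists>s. z = fps_to_fls s \<and> s $ 0 = y)"

lemma fls_at_const: "fls_at (fls_const y) y"
  unfolding fls_at_def by (rule exI[of _ "fps_const y"]) (simp add: fls_eq_iff)

lemma fls_at_add: "fls_at z y \<Longrightarrow> fls_at z' y' \<Longrightarrow> fls_at (z + z') (y + y')"
  unfolding fls_at_def by (metis fps_add_nth fps_to_fls_plus)

lemma fls_at_diff: "fls_at z y \<Longrightarrow> fls_at z' y' \<Longrightarrow> fls_at (z - z') (y - y')"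
  unfolding fls_at_def by (metis fps_sub_nth fps_to_fls_minus)

lemma fls_at_mult: "fls_at z y \<Longrightarrow> fls_at z' y' \<Longrightarrow> fls_at (z * z') (y * y')"
  unfolding fls_at_def by (metis fps_mult_nth_0 fls_times_fps_to_fls)

lemma fls_at_uminus: "fls_at z y \<Longrightarrow> fls_at (- z) (- y)"
  unfolding fls_at_def by (metis fps_neg_nth fps_to_fls_uminus)

lemma fls_at_nonzero: "fls_at z y \<Longrightarrow> y \<noteq> 0 \<Longrightarrow> fls_subdegree z = 0"
  unfolding fls_at_def by (auto simp: fls_subdegree_fls_to_fps)

lemma fls_at_subdegree_nonneg: "fls_at z y \<Longrightarrow> 0 \<le> fls_subdegree z"
  by (auto simp: fls_at_def fls_subdegree_fls_to_fps)

lemma fls_at_unique: "fls_at z y \<Longrightarrow> fls_at z y' \<Longrightarrow> y = y'"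
  by (auto simp: fls_at_def)

lemma fls_atI: "0 \<le> fls_subdegree z \<Longrightarrow> fls_at z (fls_nth z 0)"
  unfolding fls_at_def by (rule exI[of _ "fls_regpart z"]) simp

lemma fls_at_0_iff: "z \<noteq> 0 \<Longrightarrow> fls_at z 0 \<longleftrightarrow> 0 < fls_subdegree z"
proof
  assume "z \<noteq> 0" "fls_at z 0"
  then show "0 < fls_subdegree z" by (auto simp: fls_at_def fls_subdegree_fls_to_fps subdegree_eq_0_iff intro!: gr0I)
next
  assume "0 < fls_subdegree z"
  then show "fls_at z 0" using fls_atI[of z] fls_eq0_below_subdegree[of 0 z] by simp
qed

lemma fls_at_divide:
  assumes "fls_at z y" "fls_at z' y'" "y' \<noteq> 0"
  shows "fls_at (z / z') (y / y')"
proof -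
  have "z' \<noteq> 0" using assms by (auto simp: fls_at_def)
  then have "fls_at (inverse z') (fls_nth (inverse z') 0)"
    using fls_at_nonzero[OF assms(2,3)] by (intro fls_atI) simp
  from fls_at_mult[OF this assms(2)] \<open>z' \<noteq> 0\<close> have "fls_at 1 (fls_nth (inverse z') 0 * y')" by simp
  moreover have "fls_at 1 (1::'a)" using fls_at_const[of 1] by simp
  ultimately have "fls_nth (inverse z') 0 * y' = 1" by (rule fls_at_unique)
  then have "fls_nth (inverse z') 0 = inverse y'" by (metis inverse_unique mult.commute)
  then show ?thesis
    using fls_at_mult[OF assms(1) \<open>fls_at (inverse z') _\<close>] by (simp add: divide_inverse)
qed

lemma ring_hom_total_fls_const: "ring_hom_total fls_const"
  by (auto simp: ring_hom_total_def intro: fls_eqI)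

lemma fls_at_poly_hom: "fls_at U a \<Longrightarrow> fls_at (poly_hom fls_const U p) (poly p a)"
  by (induction p) (auto simp: poly_hom_0 poly_hom_pCons intro!: fls_at_add fls_at_mult fls_at_const
    fls_at_const[of 0, simplified])

lemma fls_at_poly_hom2:
  "fls_at U a \<Longrightarrow> fls_at V b \<Longrightarrow> fls_at (poly_hom (poly_hom fls_const U) V p) (poly_hom (\<lambda>q. poly q a) b p)"
  by (induction p) (auto simp: poly_hom_0 poly_hom_pCons intro!: fls_at_add fls_at_mult fls_at_poly_hom
    fls_at_const[of 0, simplified])

text \<open>The factor (u - a)^m of p, with m the order, becomes X^(e m), and the cofactor has a
  nonzero value at a. The exponent e is the ramification index.\<close>

lemma fls_subdegree_poly_hom_finite:
  fixes p :: "'k::field poly"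
  assumes "p \<noteq> 0" and e: "e > 0"
  shows "fls_subdegree (poly_hom fls_const (fls_const a + fls_X ^ e) p) = int e * int (order a p)"
proof -
  note s = ring_hom_total_simps[OF ring_hom_total_poly_hom[OF ring_hom_total_fls_const]]
  let ?ev = "poly_hom fls_const (fls_const a + fls_X ^ e)"
  obtain q where q: "p = [:- a, 1:] ^ order a p * q" and "\<not> [:- a, 1:] dvd q"
    using order_decomp[OF assms(1)] by blast
  then have qa: "poly q a \<noteq> 0" by (simp add: poly_eq_0_iff_dvd)
  have "fls_at (fls_X ^ e) (0::'k)"
    using e by (subst fls_at_0_iff) simp_all
  from fls_at_add[OF fls_at_const this] have "fls_at (fls_const a + fls_X ^ e) a" by simp
  from fls_at_nonzero[OF fls_at_poly_hom[OF this] qa] have 1: "fls_subdegree (?ev q) = 0" .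
  have "?ev [:- a, 1:] = fls_X ^ e" by (simp add: poly_hom_pCons poly_hom_0)
  then have p: "?ev p = (fls_X ^ e) ^ order a p * ?ev q" by (subst q) (simp only: s)
  have "?ev q \<noteq> 0"
    using fls_at_poly_hom[OF \<open>fls_at (fls_const a + fls_X ^ e) a\<close>, of q] qa by (auto simp: fls_at_def)
  then have "fls_subdegree (?ev p) = fls_subdegree ((fls_X ^ e :: 'k fls) ^ order a p)" unfolding p by (simp add: 1)
  then show ?thesis by (simp add: fls_subdegree_pow)
qed

lemma fls_subdegree_poly_hom_infinity:
  fixes p :: "'k::field poly"
  assumes "p \<noteq> 0"
  shows "poly_hom fls_const fls_X_inv p \<noteq> 0 \<and> fls_subdegree (poly_hom fls_const fls_X_inv p) = - int (degree p)"
  using assms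
proof (induction p)
  case (pCons a p)
  show ?case
  proof (cases "p = 0")
    case False
    let ?y = "fls_X_inv * poly_hom fls_const fls_X_inv p"
    have y: "?y \<noteq> 0" "fls_subdegree ?y = - 1 - int (degree p)" using pCons.IH[OF False] by simp_all
    then have "fls_subdegree (fls_const a + ?y) = - 1 - int (degree p)"
      by (subst fls_subdegree_add_eq2) simp_all
    moreover from this have "fls_const a + ?y \<noteq> 0" by auto
    ultimately show ?thesis using False by (simp add: poly_hom_pCons)
  qed (use pCons in \<open>simp add: poly_hom_pCons poly_hom_0\<close>)
qed simp

lemma sum_order_eq_degree:
  fixes p :: "'k::alg_closed_field poly"
  assumes p: "p \<noteq> 0" and S: "finite S" "{x. poly p x = 0} \<subseteq> S"
  shows "(\<Sum>a\<in>S. order a p) = degree p"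
proof -
  obtain A where A: "size A = degree p" "p = smult (lead_coeff p) (\<Prod>x\<in>#A. [:-x, 1:])"
    using alg_closed_imp_factorization[OF p] by blast
  have "proots (\<Prod>x\<in>#A. [:-x, 1:]) = A" 
  proof (induction A)
    case (add x A)
    have "(\<Prod>x\<in>#A. [:-x, 1:]) \<noteq> 0" by (auto simp: prod_mset_zero_iff)
    then show ?case using add by (simp add: proots_mult del: mult_pCons_left)
  qed simp
  then have "proots p = A" using p A(2) by (metis proots_smult leading_coeff_0_iff)
  then have c: "order a p = count A a" for a using p by (metis count_proots)
  have "set_mset A \<subseteq> S" using S(2) p \<open>proots p = A\<close> by (metis set_count_proots)
  then have "(\<Sum>a\<in>S. count A a) = size A"
    unfolding size_multiset_overloaded_eq by (intro sum.mono_neutral_right S) (auto simp: not_in_iff)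
  then show ?thesis by (simp add: c A(1))
qed

section \<open>Places from parametrizations by Laurent series\<close>

locale series_point = generic_point c d fls_const U V
  for c d :: "'a::field" and U V :: "'a alg_closure fls"
begin

definition series_ord :: "'a fun_univ \<Rightarrow> int" where
  "series_ord z = fls_subdegree (spec z)"

lemma series_ord_place:
  assumes "\<exists>z\<in>K. series_ord z = 1"
  shows "series_ord \<in> places c d"
  unfolding places_def
proof (intro CollectI conjI allI impI ballI)
  fix z assume "z \<notin> K - {0}"
  then show "series_ord z = 0" by (auto simp: series_ord_def spec_outside spec_0)
next
  fix x y assume xy: "x \<in> K - {0}" "y \<in> K - {0}"
  then show "series_ord (x * y) = series_ord x + series_ord y"
    by (simp add: series_ord_def spec_mult spec_eq_0_iff)
  assume "x + y \<noteq> 0"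
  then have "spec x + spec y \<noteq> 0"
    using xy spec_eq_0_iff[of "x + y"] by (simp add: spec_add K_add)
  then show "min (series_ord x) (series_ord y) \<le> series_ord (x + y)"
    using xy by (simp add: series_ord_def spec_add fls_plus_subdegree)
qed (use assms in \<open>simp_all add: series_ord_def spec_const\<close>)

end

section \<open>Expansions of u and v over the points of the projective line\<close>

context edwards_curve
begin

lemma series_point_uminus: "series_point c d U V \<Longrightarrow> series_point c d U (- V)"
  by (simp add: series_point_def generic_point_def generic_point_axioms_def)

text \<open>The points \<open>a\<close> of the projective line over \<open>k\<close>, with \<open>None\<close> for infinity, and the places
  above them in the extension \<open>k(u, v)\<close> of \<open>k(u)\<close>.\<close>

definition ramified :: "'a alg_closure option \<Rightarrow> bool" where
  "ramified a \<longleftrightarrow> (\<exists>x. a = Some x \<and> (poly vnum x = 0 \<or> poly vden x = 0))"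

definition ram_index :: "'a alg_closure option \<Rightarrow> nat" where
  "ram_index a = (if ramified a then 2 else 1)"

text \<open>The variable X is a local parameter of the curve: 1/u at infinity and u - x at an
  ordinary x. At a branch point v^2 has odd order in u - x, and X^2 = u - x makes that order even,
  so that v has an expansion.\<close>

definition u_series :: "'a alg_closure option \<Rightarrow> 'a alg_closure fls" where
  "u_series a = (case a of None \<Rightarrow> fls_X_inv | Some x \<Rightarrow> fls_const x + fls_X ^ ram_index a)"

definition line_ord :: "'a alg_closure option \<Rightarrow> 'a alg_closure poly \<Rightarrow> int" where
  "line_ord a p = (case a of None \<Rightarrow> - int (degree p) | Some x \<Rightarrow> int (order x p))"

definition v_series :: "'a alg_closure option \<Rightarrow> 'a alg_closure fls" where
  "v_series a = (SOME y. y^2 = poly_hom fls_const (u_series a) vnum / poly_hom fls_const (u_series a) vden)"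

lemma ram_index_pos: "ram_index a > 0"
  by (simp add: ram_index_def)

lemma fls_subdegree_u_series:
  assumes "p \<noteq> 0"
  shows "fls_subdegree (poly_hom fls_const (u_series a) p) = int (ram_index a) * line_ord a p"
proof (cases a)
  case None
  then show ?thesis using fls_subdegree_poly_hom_infinity[OF assms]
    by (simp add: u_series_def line_ord_def ram_index_def ramified_def)
next
  case (Some x)
  then show ?thesis using fls_subdegree_poly_hom_finite[OF assms ram_index_pos[of a], of x]
    by (simp add: u_series_def line_ord_def)
qed

lemma u_series_nonconst: "u_series a \<notin> range fls_const"
proof
  assume "u_series a \<in> range fls_const"
  then obtain e where e: "u_series a = fls_const e" by blast
  show False
  proof (cases a)
    case None
    then show False using arg_cong[OF e, of fls_subdegree] by (simp add: u_series_def)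
  next
    case (Some x)
    have "fls_nth (u_series a) (int (ram_index a)) = 0" using ram_index_pos[of a] by (simp add: e)
    then show False using ram_index_pos[of a] by (simp add: u_series_def Some)
  qed
qed

lemma u_series_poly_nonzero: "p \<noteq> 0 \<Longrightarrow> poly_hom fls_const (u_series a) p \<noteq> 0"
  by (rule poly_hom_nonzero[OF ring_hom_total_fls_const u_series_nonconst])

lemma order_difference_of_squares:
  fixes e x :: "'a alg_closure"
  assumes "e \<noteq> 0" "x \<noteq> 0"
  shows "order x (smult e [:x^2, 0, -1:]) = 1"
proof -
  have eq: "[:x^2, 0, -1:] = [:-x, 1:] * [:-x, -1:]" by (simp add: power2_eq_square)
  have "poly [:-x, -1:] x = -x + x * -1" by simp
  also have "\<dots> = - (2 * x)" by Groebner_Basis.algebra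
  finally have "poly [:-x, -1:] x \<noteq> 0" using assms(2) two_ac by (metis neg_equal_0_iff_equal no_zero_divisors)
  then have 0: "order x [:-x, -1:] = 0" by (rule order_0I)
  have 1: "order x [:-x, 1:] = 1" using order_power_n_n[of x 1] by simp
  have nz: "[:-x, 1:] * [:-x, -1:] \<noteq> 0" unfolding eq[symmetric] by simp
  have "order x [:x^2, 0, -1:] = 1" unfolding eq order_mult[OF nz] 0 1 by simp
  then show ?thesis using assms(1) by (simp only: order_smult not_False_eq_True)
qed

text \<open>The branch points are the square roots of c^2 and of 1 / (c^2 d). They are simple roots
  because 2 \<noteq> 0, and the two pairs are disjoint because c^4 d \<noteq> 1.\<close>

lemma order_vnum_vden:
  assumes "ramified (Some x)"
  shows "(order x vnum = 1 \<and> order x vden = 0) \<or> (order x vnum = 0 \<and> order x vden = 1)"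
proof -
  let ?C = "to_ac c" and ?D = "to_ac d"
  have C: "?C \<noteq> 0" "?D \<noteq> 0" using c d by simp_all
  have CD: "?C^2 * ?C^2 * ?D \<noteq> 1"
  proof
    assume "?C^2 * ?C^2 * ?D = 1"
    then have "to_ac (c^4 * d) = to_ac 1" by (simp add: power2_eq_square power4_eq_xxxx mult.assoc)
    then show False unfolding to_ac_eq_iff using c4d by simp
  qed
  show ?thesis
  proof (cases "poly vnum x = 0")
    case True
    then have x: "x^2 = ?C^2" by (simp add: vnum_def power2_eq_square)
    then have "x \<noteq> 0" using C by auto
    have "poly vden x = 1 - ?C^2 * ?D * x^2" by (simp add: vden_def power2_eq_square mult_ac)
    then have "poly vden x \<noteq> 0" using CD unfolding x by (simp add: mult_ac)
    then have "order x vden = 0" by (rule order_0I)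
    moreover have "order x vnum = 1"
      using order_difference_of_squares[of 1 x] \<open>x \<noteq> 0\<close> by (simp add: vnum_def flip: x)
    ultimately show ?thesis by simp
  next
    case False
    then have "order x vnum = 0" by (rule order_0I)
    have "poly vden x = 0" using assms False by (auto simp: ramified_def)
    then have x: "?C^2 * ?D * x^2 = 1" by (simp add: vden_def power2_eq_square mult_ac)
    then have "x \<noteq> 0" by auto
    have "vden = smult (?C^2 * ?D) [:x^2, 0, -1:]" using x by (simp add: vden_def)
    then have "order x vden = 1" using order_difference_of_squares[of "?C^2 * ?D" x] \<open>x \<noteq> 0\<close> C by simp
    then show ?thesis using \<open>order x vnum = 0\<close> by simp
  qed
qed

lemma line_ord_unramified:
  assumes "\<not> ramified a"
  shows "line_ord a vnum = line_ord a vden"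
proof (cases a)
  case None
  \<comment> \<open>Equal degrees: v^2 has order 0 at infinity, which is therefore
    unramified.\<close>
  have "degree vnum = 2" "degree vden = 2" using c d by (simp_all add: vnum_def vden_def)
  then show ?thesis by (simp add: None line_ord_def)
next
  case (Some x)
  then have "poly vnum x \<noteq> 0" "poly vden x \<noteq> 0" using assms by (auto simp: ramified_def)
  then show ?thesis by (simp add: Some line_ord_def order_0I)
qed

lemma v_series_square:
  "v_series a ^ 2 = poly_hom fls_const (u_series a) vnum / poly_hom fls_const (u_series a) vden"
proof -
  let ?W = "poly_hom fls_const (u_series a) vnum / poly_hom fls_const (u_series a) vden"
  have "fls_subdegree ?W = int (ram_index a) * (line_ord a vnum - line_ord a vden)"
    by (simp add: fls_divide_subdegree u_series_poly_nonzero fls_subdegree_u_series right_diff_distrib)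
  then have "even (fls_subdegree ?W)"
    by (cases "ramified a") (simp_all add: line_ord_unramified ram_index_def)
  then have "\<exists>y. y^2 = ?W" by (rule fls_has_sqrt[OF two_ac])
  then show ?thesis unfolding v_series_def by (rule someI_ex)
qed

lemma v_series_nonzero: "v_series a \<noteq> 0"
  using v_series_square[of a] u_series_poly_nonzero[of vnum a] u_series_poly_nonzero[of vden a]
  by (metis divide_eq_0_iff vden_nonzero vnum_nonzero zero_power2)

lemma fls_subdegree_v_series:
  "2 * fls_subdegree (v_series a) = int (ram_index a) * (line_ord a vnum - line_ord a vden)"
  using arg_cong[OF v_series_square[of a], of fls_subdegree] v_series_nonzero[of a]
  by (simp add: fls_subdegree_pow fls_divide_subdegree u_series_poly_nonzero fls_subdegree_u_series right_diff_distrib)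

lemma series_point_series: "series_point c d (u_series a) (v_series a)"
proof -
  let ?C = "fls_const (to_ac c)" and ?D = "fls_const (to_ac d)"
  note s = ring_hom_total_simps[OF ring_hom_total_fls_const]
  have "poly_hom fls_const (u_series a) vden * v_series a ^ 2 = poly_hom fls_const (u_series a) vnum"
    unfolding v_series_square using u_series_poly_nonzero[OF vden_nonzero] by simp
  then have "u_series a^2 + v_series a^2 = ?C^2 * (1 + ?D * u_series a^2 * v_series a^2)"
    by (simp add: vden_def vnum_def poly_hom_pCons poly_hom_0 algebra_simps power2_eq_square)
  then show ?thesis
    by unfold_locales (simp_all add: u_series_nonconst ring_hom_total_fls_const)
qed

definition place_pos :: "'a alg_closure option \<Rightarrow> 'a fun_univ \<Rightarrow> int" where
  "place_pos a = series_point.series_ord c d (u_series a) (v_series a)"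

definition place_neg :: "'a alg_closure option \<Rightarrow> 'a fun_univ \<Rightarrow> int" where
  "place_neg a = series_point.series_ord c d (u_series a) (- v_series a)"

definition places_above :: "'a alg_closure option \<Rightarrow> ('a fun_univ \<Rightarrow> int) set" where
  "places_above a = {place_pos a, place_neg a}"

lemma places_aboveE:
  assumes "ord \<in> places_above a"
  obtains V where "V = v_series a \<or> V = - v_series a" "series_point c d (u_series a) V"
    "ord = series_point.series_ord c d (u_series a) V"
  using assms series_point_series[of a] series_point_uminus[OF series_point_series[of a]]
  by (auto simp: places_above_def place_pos_def place_neg_def)

lemma fls_subdegree_v_series_ramified:
  assumes "ramified a"
  shows "fls_subdegree (v_series a) = 1 \<or> fls_subdegree (v_series a) = - 1"
proof -
  obtain x where x: "a = Some x" using assms by (auto simp: ramified_def)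
  then show ?thesis
    using order_vnum_vden[of x] assms fls_subdegree_v_series[of a]
    by (auto simp: ram_index_def line_ord_def)
qed

text \<open>An element of order 1 is v or 1/v at a branch point, 1/u at infinity, and u - x
  otherwise.\<close>

lemma places_above_places: "places_above a \<subseteq> places c d"
proof
  fix ord assume "ord \<in> places_above a"
  then obtain V where V: "V = v_series a \<or> V = - v_series a" "series_point c d (u_series a) V"
    and ord: "ord = series_point.series_ord c d (u_series a) V"
    by (rule places_aboveE)
  interpret V: series_point c d "u_series a" V by (rule V(2))
  have "\<exists>z\<in>K. V.series_ord z = 1"
  proof (cases "ramified a")
    case True
    have "fls_subdegree V = fls_subdegree (v_series a)" using V(1) by auto
    then have "V.series_ord (coord_v c d) = 1 \<or> V.series_ord (inverse (coord_v c d)) = 1"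
      using fls_subdegree_v_series_ramified[OF True]
      by (auto simp: V.series_ord_def V.spec_v V.spec_inverse K_intros)
    then show ?thesis using K_v K_inverse[OF K_v] by blast
  next
    case False
    show ?thesis
    proof (cases a)
      case None
      then have u: "u_series a = fls_X_inv" by (simp add: u_series_def)
      have "V.series_ord (inverse coord_u) = fls_subdegree (inverse (u_series a))"
        by (simp only: V.series_ord_def V.spec_u V.spec_inverse K_intros)
      also have "\<dots> = 1" unfolding u by (simp add: fls_inverse_X_inv)
      finally have "V.series_ord (inverse coord_u) = 1" .
      then show ?thesis using K_inverse[OF K_u] by blast
    next
      case (Some x)
      have "ram_index a = 1" using False by (simp add: ram_index_def)
      then have u: "u_series a = fls_const x + fls_X" using Some by (simp add: u_series_def)
      have "V.series_ord (coord_u - geom_const x) = fls_subdegree (u_series a - fls_const x)"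
        by (simp only: V.series_ord_def V.spec_u V.spec_const V.spec_diff K_intros)
      also have "\<dots> = 1" unfolding u by simp
      finally have "V.series_ord (coord_u - geom_const x) = 1" .
      then show ?thesis using K_diff[OF K_u K_const] by blast
    qed
  qed
  then show "ord \<in> places c d" unfolding ord by (rule V.series_ord_place)
qed

text \<open>A place determines the x at which u - x has positive order; for infinity there is
  none.\<close>

lemma places_above_disjoint:
  assumes "ord \<in> places_above a" "ord \<in> places_above b"
  shows "a = b"
proof -
  have "0 < ord (coord_u - geom_const x) \<longleftrightarrow> a = Some x" if ord: "ord \<in> places_above a" for a x
  proof -
    obtain V where V: "series_point c d (u_series a) V" "ord = series_point.series_ord c d (u_series a) V"
      using ord by (rule places_aboveE)
    interpret V: series_point c d "u_series a" V by (rule V(1))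
    have o: "ord (coord_u - geom_const x) = fls_subdegree (u_series a - fls_const x)"
      by (simp add: V(2) V.series_ord_def V.spec_u V.spec_const V.spec_diff K_intros)
    show ?thesis
    proof (cases a)
      case None
      have "fls_subdegree (fls_X_inv + fls_const (- x)) = - 1"
        by (subst fls_subdegree_add_eq1) simp_all
      then show ?thesis unfolding o by (simp add: u_series_def None)
    next
      case (Some y)
      show ?thesis
      proof (cases "x = y")
        case True
        then show ?thesis unfolding o using ram_index_pos[of a] by (simp add: u_series_def Some)
      next
        case False
        have "fls_at (fls_X ^ ram_index a) (0 :: 'a alg_closure)"
          using ram_index_pos[of a] by (subst fls_at_0_iff) simp_all
        then have "fls_at (u_series a - fls_const x) (y + 0 - x)"
          unfolding u_series_def Some option.case by (intro fls_at_diff fls_at_add fls_at_const)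
        then show ?thesis unfolding o using False by (subst fls_at_nonzero) (auto simp: Some)
      qed
    qed
  qed
  from this[OF assms(1)] this[OF assms(2)] show ?thesis by (metis not_Some_eq)
qed

section \<open>Norms, and the comparison of zeros with poles\<close>

text \<open>The norm of \<open>z\<close> in \<open>k(u)\<close> is \<open>A(u) / B(u)\<close>.\<close>

lemma norm_exists:
  assumes "z \<in> K" "z \<noteq> 0"
  obtains A B where "A \<noteq> 0" "B \<noteq> 0"
    "\<forall>U V. series_point c d U V \<longrightarrow>
      specialize c d fls_const U V z * specialize c d fls_const U (- V) z * poly_hom fls_const U B =
      poly_hom fls_const U A"
proof -
  obtain p r where z: "geom_fun c d r \<noteq> 0" "z = geom_fun c d p / geom_fun c d r" using assms(1) by (rule K_E)
  obtain n p0 p1 h where p: "[:vden^n:] * p = [:p0, p1:] + [:- vnum, 0, vden:] * h" using curve_reduce by blast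
  obtain m r0 r1 k where r: "[:vden^m:] * r = [:r0, r1:] + [:- vnum, 0, vden:] * k" using curve_reduce by blast
  have "gen.ev2 p \<noteq> 0" "gen.ev2 r \<noteq> 0" using z assms(2) by (auto simp: geom_fun_eq)
  then have nz: "\<not> (p0 = 0 \<and> p1 = 0)" "\<not> (r0 = 0 \<and> r1 = 0)"
    unfolding gen.ev2_eq_0_iff[OF p] gen.ev2_eq_0_iff[OF r] by simp_all
  define Np Nr where "Np = p0^2 * vden - p1^2 * vnum" and "Nr = r0^2 * vden - r1^2 * vnum"
  have N: "Np \<noteq> 0" "Nr \<noteq> 0" using vsq_not_square nz by (auto simp: Np_def Nr_def)
  \<comment> \<open>The norm of the numerator p is \<open>Np\<close> / \<open>vden\<close>^(2n+1),
    that of the denominator r is \<open>Nr\<close> / \<open>vden\<close>^(2m+1); one factor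
    \<open>vden\<close> cancels in the quotient.\<close>
  show ?thesis
  proof (rule that[of "Np * vden^(2*m)" "Nr * vden^(2*n)"]; (intro allI impI)?)
    fix U V assume V: "series_point c d U V"
    interpret V: series_point c d U V by (rule V)
    interpret W: series_point c d U "- V" by (rule series_point_uminus[OF V])
    let ?D = "V.ev1 vden"
    have D: "?D \<noteq> 0" by simp
    have "?D^(2*n) * (V.ev2 p * W.ev2 p) * ?D = (?D^n * V.ev2 p) * (?D^n * W.ev2 p) * ?D"
      by (simp add: mult_2 power_add)
    also have "\<dots> = V.ev1 Np"
      unfolding V.ev2_reduce[OF p] W.ev2_reduce[OF p] Np_def V.linear_norm[symmetric] by simp
    finally have 1: "?D^(2*n) * (V.ev2 p * W.ev2 p) * ?D = V.ev1 Np" .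
    have "?D^(2*m) * (V.ev2 r * W.ev2 r) * ?D = (?D^m * V.ev2 r) * (?D^m * W.ev2 r) * ?D"
      by (simp add: mult_2 power_add)
    also have "\<dots> = V.ev1 Nr"
      unfolding V.ev2_reduce[OF r] W.ev2_reduce[OF r] Nr_def V.linear_norm[symmetric] by simp
    finally have 2: "?D^(2*m) * (V.ev2 r * W.ev2 r) * ?D = V.ev1 Nr" .
    have "V.ev2 r \<noteq> 0" "W.ev2 r \<noteq> 0" using z by (auto simp: V.ev2_eq_0_iff_geom_fun W.ev2_eq_0_iff_geom_fun)
    then show "V.spec z * W.spec z * V.ev1 (Nr * vden^(2*n)) = V.ev1 (Np * vden^(2*m))"
      unfolding V.ev1_simps 1[symmetric] 2[symmetric] z(2) V.spec_eq[OF z(1)] W.spec_eq[OF z(1)] by simp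
  qed (use N in simp_all)
qed

text \<open>At a branch point the orders of p0 and of v p1 have different parity. So nothing cancels
  in p0 + v p1, and the sign of v does not affect the order.\<close>

lemma place_neg_eq_place_pos:
  assumes "ramified a"
  shows "place_neg a = place_pos a"
proof
  fix z
  interpret V: series_point c d "u_series a" "v_series a" by (rule series_point_series)
  interpret W: series_point c d "u_series a" "- v_series a" by (rule series_point_uminus[OF series_point_series])
  let ?D = "V.ev1 vden"
  have lin: "fls_subdegree (V.ev1 p0 + v_series a * V.ev1 p1) = fls_subdegree (V.ev1 p0 + - v_series a * V.ev1 p1)"
    for p0 p1
  proof (cases "p0 = 0 \<or> p1 = 0")
    case True
    then show ?thesis by (auto simp: poly_hom_0)
  next
    case False
    have "even (fls_subdegree (V.ev1 p0))" "odd (fls_subdegree (v_series a * V.ev1 p1))"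
      using False fls_subdegree_v_series_ramified[OF assms] assms
      by (auto simp: fls_subdegree_u_series ram_index_def v_series_nonzero)
    then have ne: "fls_subdegree (V.ev1 p0) \<noteq> fls_subdegree (v_series a * V.ev1 p1)" by metis
    have nz: "V.ev1 p0 \<noteq> 0" "v_series a * V.ev1 p1 \<noteq> 0" using False by (simp_all add: v_series_nonzero)
    show ?thesis
    proof (cases "fls_subdegree (V.ev1 p0) < fls_subdegree (v_series a * V.ev1 p1)")
      case True
      then show ?thesis using nz
        by (simp add: fls_subdegree_add_eq1 fls_subdegree_diff_eq1 del: fls_subdegree_mult)
    next
      case False
      then show ?thesis using nz ne
        by (simp add: fls_subdegree_add_eq2 fls_subdegree_diff_eq2 del: fls_subdegree_mult)
    qed
  qed
  have ev2: "fls_subdegree (V.ev2 p) = fls_subdegree (W.ev2 p)" for p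
  proof (cases "geom_fun c d p = 0")
    case True
    then have "V.ev2 p = 0" "W.ev2 p = 0" by (simp_all add: V.ev2_eq_0_iff_geom_fun W.ev2_eq_0_iff_geom_fun)
    then show ?thesis by simp
  next
    case False
    then have nz: "V.ev2 p \<noteq> 0" "W.ev2 p \<noteq> 0" by (simp_all add: V.ev2_eq_0_iff_geom_fun W.ev2_eq_0_iff_geom_fun)
    obtain n p0 p1 h where p: "[:vden^n:] * p = [:p0, p1:] + [:- vnum, 0, vden:] * h" using curve_reduce by blast
    have "fls_subdegree (?D^n * V.ev2 p) = fls_subdegree (?D^n * W.ev2 p)"
      unfolding V.ev2_reduce[OF p] W.ev2_reduce[OF p] by (rule lin)
    then show ?thesis using nz by simp
  qed
  show "place_neg a z = place_pos a z"
  proof (cases "z \<in> K")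
    case True
    then obtain p r where z: "geom_fun c d r \<noteq> 0" "z = geom_fun c d p / geom_fun c d r" by (rule K_E)
    show ?thesis
    proof (cases "z = 0")
      case False
      then have "geom_fun c d p \<noteq> 0" using z by auto
      then have "V.ev2 p \<noteq> 0" "W.ev2 p \<noteq> 0" "V.ev2 r \<noteq> 0" "W.ev2 r \<noteq> 0"
        using z(1) by (simp_all add: V.ev2_eq_0_iff_geom_fun W.ev2_eq_0_iff_geom_fun)
      then show ?thesis
        unfolding place_neg_def place_pos_def V.series_ord_def W.series_ord_def z(2) V.spec_eq[OF z(1)] W.spec_eq[OF z(1)]
        by (simp add: fls_divide_subdegree ev2)
    qed (simp add: place_neg_def place_pos_def V.series_ord_def W.series_ord_def V.spec_0 W.spec_0)
  qed (simp add: place_neg_def place_pos_def V.series_ord_def W.series_ord_def V.spec_outside W.spec_outside)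
qed

lemma coord_v_nonconst: "coord_v c d \<noteq> geom_const b"
proof
  assume "coord_v c d = geom_const b"
  then have "gen.ev1 [:- b:] + coord_v c d * gen.ev1 1 = 0"
    by (simp add: poly_hom_const gen.h_simps gen.ev1_simps)
  then show False unfolding gen.linear_eq_0_iff by simp
qed

text \<open>Away from the branch points v has a nonzero finite value b at one place and -b at the
  other, so v - b vanishes at only one of them.\<close>

lemma place_neg_neq_place_pos:
  assumes "\<not> ramified a"
  shows "place_neg a \<noteq> place_pos a"
proof -
  interpret V: series_point c d "u_series a" "v_series a" by (rule series_point_series)
  interpret W: series_point c d "u_series a" "- v_series a" by (rule series_point_uminus[OF series_point_series])
  define b where "b = fls_nth (v_series a) 0"
  have sub: "fls_subdegree (v_series a) = 0"
    using fls_subdegree_v_series[of a] line_ord_unramified[OF assms] by simp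
  then have at: "fls_at (v_series a) b" unfolding b_def by (intro fls_atI) simp
  have "b \<noteq> 0" using nth_fls_subdegree_nonzero[OF v_series_nonzero[of a]] by (simp add: b_def sub)
  let ?z = "coord_v c d - geom_const b"
  have z: "?z \<in> K" "?z \<noteq> 0" using coord_v_nonconst by (simp_all add: K_intros)
  have "fls_at (V.spec ?z) 0"
    using fls_at_diff[OF at fls_at_const[of b]] by (simp add: V.spec_diff V.spec_v V.spec_const K_intros)
  moreover have "V.spec ?z \<noteq> 0" using z(2) unfolding V.spec_eq_0_iff[OF z(1)] .
  ultimately have "fls_at (V.spec ?z) 0 \<and> V.spec ?z \<noteq> 0" ..
  then have "0 < place_pos a ?z"
    unfolding place_pos_def V.series_ord_def using fls_at_0_iff by blast
  moreover have "- b - b = - (2 * b)" by Groebner_Basis.algebra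
  then have "- b - b \<noteq> 0" using \<open>b \<noteq> 0\<close> two_ac by (metis neg_equal_0_iff_equal no_zero_divisors)
  then have "place_neg a ?z = 0"
    using fls_at_nonzero[OF fls_at_diff[OF fls_at_uminus[OF at] fls_at_const[of b]]]
    by (simp add: place_neg_def W.series_ord_def W.spec_diff W.spec_v W.spec_const K_intros)
  ultimately show ?thesis by auto
qed

text \<open>The two signs of v together give e times the order of the norm. For e = 2 they give the
  same place, which the set counts once; for e = 1 there are two places.\<close>

lemma sum_places_above:
  assumes "z \<in> K" "z \<noteq> 0" and AB: "A \<noteq> 0" "B \<noteq> 0"
    and norm: "\<And>U V. series_point c d U V \<Longrightarrow>
      specialize c d fls_const U V z * specialize c d fls_const U (- V) z * poly_hom fls_const U B =
      poly_hom fls_const U A"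
  shows "(\<Sum>ord\<in>places_above a. ord z) = line_ord a A - line_ord a B"
proof -
  interpret V: series_point c d "u_series a" "v_series a" by (rule series_point_series)
  interpret W: series_point c d "u_series a" "- v_series a" by (rule series_point_uminus[OF series_point_series])
  have "V.spec z \<noteq> 0" "W.spec z \<noteq> 0" "V.ev1 A \<noteq> 0" "V.ev1 B \<noteq> 0"
    using assms by (simp_all add: V.spec_eq_0_iff W.spec_eq_0_iff)
  then have "place_pos a z + place_neg a z = int (ram_index a) * (line_ord a A - line_ord a B)"
    using arg_cong[OF norm[OF V.series_point_axioms], of fls_subdegree] AB
    by (simp add: place_pos_def place_neg_def V.series_ord_def W.series_ord_def fls_subdegree_u_series algebra_simps)
  then show ?thesis
    using place_neg_eq_place_pos[of a] place_neg_neq_place_pos[of a]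
    by (cases "ramified a") (auto simp: places_above_def ram_index_def)
qed

text \<open>The square of the expansion of v has the value y^2 at X = 0, so one of the two signs
  gives the value y. The denominator of v^2 is nonzero at x because d is a nonsquare.\<close>

lemma series_at_point:
  assumes "(x, y) \<in> edwards_points c d"
  obtains U V where "series_point c d U V" "fls_at U (to_ac x)" "fls_at V (to_ac y)"
    "series_point.series_ord c d U V \<in> places_above (Some (to_ac x))"
proof -
  let ?a = "Some (to_ac x)"
  let ?U = "u_series ?a" and ?V = "v_series ?a"
  have "fls_at (fls_X ^ ram_index ?a) (0 :: 'a alg_closure)"
    using ram_index_pos[of ?a] by (subst fls_at_0_iff) simp_all
  from fls_at_add[OF fls_at_const this] have U: "fls_at ?U (to_ac x)" by (simp add: u_series_def)
  have eq: "x^2 + y^2 = c^2 * (1 + d * x^2 * y^2)" using assms by (simp add: edwards_points_def)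
  have vden: "poly vden (to_ac x) = to_ac (1 - c^2 * d * x^2)"
    and vnum: "poly vnum (to_ac x) = to_ac (c^2 - x^2)"
    by (simp_all add: vden_def vnum_def power2_eq_square mult_ac)
  have nz: "1 - c^2 * d * x^2 \<noteq> 0"
  proof
    assume *: "1 - c^2 * d * x^2 = 0"
    then have "x \<noteq> 0" by auto
    then have "d = (1 / (c * x))^2" using * c by (simp add: power_divide power_mult_distrib eq_divide_eq mult_ac)
    then show False using nonsquare by blast
  qed
  then have "fls_at (?V^2) (poly vnum (to_ac x) / poly vden (to_ac x))"
    unfolding v_series_square by (intro fls_at_divide fls_at_poly_hom U) (simp add: vden del: to_ac_diff)
  moreover have "y^2 = (c^2 - x^2) / (1 - c^2 * d * x^2)"
    using nz eq by (simp add: eq_divide_eq algebra_simps)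
  ultimately have V2: "fls_at (?V^2) (to_ac y^2)"
    unfolding vden vnum by (metis to_ac_divide to_ac_power)
  then have "0 \<le> fls_subdegree ?V" using fls_at_subdegree_nonneg[OF V2] by (simp add: fls_subdegree_pow)
  then obtain b where b: "fls_at ?V b" using fls_atI by blast
  then have "b^2 = to_ac y^2" using fls_at_unique[OF fls_at_mult[OF b b]] V2 by (simp add: power2_eq_square)
  then have "b = to_ac y \<or> b = - to_ac y" by (simp add: power2_eq_iff)
  then show ?thesis
  proof
    assume "b = to_ac y"
    then show ?thesis using that[of ?U ?V] b U series_point_series by (simp add: places_above_def place_pos_def)
  next
    assume "b = - to_ac y"
    then have "fls_at (- ?V) (to_ac y)" using fls_at_uminus[OF b] by simp
    then show ?thesis
      using that[of ?U "- ?V"] U series_point_uminus[OF series_point_series] by (simp add: places_above_def place_neg_def)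
  qed
qed

text \<open>Over \<open>u = a\<close> the orders of \<open>z\<close> add up to the order of its norm, a rational function of \<open>u\<close>,
  and the orders of a rational function over the projective line add up to zero.\<close>

lemma zeros_le_poles:
  assumes z: "z \<in> K" "z \<noteq> 0" and Z: "finite Z" "Z \<subseteq> edwards_points c d"
    and zero: "\<And>x y U V. (x, y) \<in> Z \<Longrightarrow> series_point c d U V \<Longrightarrow> fls_at U (to_ac x) \<Longrightarrow> fls_at V (to_ac y) \<Longrightarrow>
      fls_at (specialize c d fls_const U V z) 0"
  obtains Q where "finite Q" "Q \<subseteq> places c d" "int (card Z) \<le> (\<Sum>ord\<in>Q. max 0 (- ord z))"
proof -
  obtain A B where AB: "A \<noteq> 0" "B \<noteq> 0"
    and norm: "\<forall>U V. series_point c d U V \<longrightarrow>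
      specialize c d fls_const U V z * specialize c d fls_const U (- V) z * poly_hom fls_const U B =
      poly_hom fls_const U A"
    using z by (rule norm_exists)
  \<comment> \<open>All roots of A and B belong to R, so with infinity it carries all of their
    orders; the first coordinates of Z make the places at Z available.\<close>
  define R where "R = {x. poly A x = 0} \<union> {x. poly B x = 0} \<union> (to_ac \<circ> fst) ` Z"
  have R: "finite R" using AB Z by (simp add: R_def poly_roots_finite)
  define S where "S = insert None (Some ` R)"
  have S: "finite S" using R by (simp add: S_def)
  define Q where "Q = (\<Union>a\<in>S. places_above a)"
  have finite: "finite Q" using S by (auto simp: Q_def places_above_def)
  have Qpl: "Q \<subseteq> places c d" using places_above_places by (auto simp: Q_def)
  have line: "(\<Sum>a\<in>S. line_ord a p) = 0" if "p \<noteq> 0" "{x. poly p x = 0} \<subseteq> R" for p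
  proof -
    have "(\<Sum>a\<in>S. line_ord a p) = - int (degree p) + (\<Sum>x\<in>R. int (order x p))"
      using R by (simp add: S_def line_ord_def sum.reindex)
    then show ?thesis using sum_order_eq_degree[OF that(1) R that(2)] by (simp flip: of_nat_sum)
  qed
  have "(\<Sum>ord\<in>Q. ord z) = (\<Sum>a\<in>S. \<Sum>ord\<in>places_above a. ord z)"
    unfolding Q_def by (rule sum.UNION_disjoint) (use S places_above_disjoint in \<open>auto simp: places_above_def\<close>)
  also have "\<dots> = (\<Sum>a\<in>S. line_ord a A) - (\<Sum>a\<in>S. line_ord a B)"
    by (simp add: sum_places_above[OF z AB norm[rule_format]] sum_subtractf)
  also have "\<dots> = 0" using AB by (simp add: line R_def subset_eq)
  finally have total: "(\<Sum>ord\<in>Q. ord z) = 0" .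
  have "\<exists>ord\<in>places_above (Some (to_ac (fst P))). 0 < ord z \<and>
      (\<exists>U V. series_point c d U V \<and> fls_at V (to_ac (snd P)) \<and> ord = series_point.series_ord c d U V)" if P: "P \<in> Z" for P
  proof -
    have "(fst P, snd P) \<in> edwards_points c d" using P Z by auto
    then obtain U V where UV: "series_point c d U V" "fls_at U (to_ac (fst P))" "fls_at V (to_ac (snd P))"
      "series_point.series_ord c d U V \<in> places_above (Some (to_ac (fst P)))"
      by (rule series_at_point)
    interpret V: series_point c d U V by (rule UV(1))
    have "fls_at (V.spec z) 0" using zero[OF _ UV(1-3)] P by simp
    moreover have "V.spec z \<noteq> 0" using z by (simp add: V.spec_eq_0_iff)
    ultimately have "0 < V.series_ord z" by (simp add: V.series_ord_def fls_at_0_iff)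
    then show ?thesis using UV by blast
  qed
  then obtain \<phi> where \<phi>: "\<And>P. P \<in> Z \<Longrightarrow> \<phi> P \<in> places_above (Some (to_ac (fst P)))" "\<And>P. P \<in> Z \<Longrightarrow> 0 < \<phi> P z"
    and \<phi>V: "\<And>P. P \<in> Z \<Longrightarrow> \<exists>U V. series_point c d U V \<and> fls_at V (to_ac (snd P)) \<and> \<phi> P = series_point.series_ord c d U V"
    by metis
  \<comment> \<open>The place also determines the second coordinate of P, as the value of v.
    Together with the disjointness over different x this makes \<phi> injective.\<close>
  have \<phi>v: "0 < \<phi> P (coord_v c d - geom_const (to_ac y)) \<longleftrightarrow> y = snd P" if P: "P \<in> Z" for P y
  proof -
    obtain U V where V: "series_point c d U V" "fls_at V (to_ac (snd P))" "\<phi> P = series_point.series_ord c d U V"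
      using \<phi>V[OF P] by blast
    interpret V: series_point c d U V by (rule V(1))
    let ?z = "coord_v c d - geom_const (to_ac y)"
    have z: "?z \<in> K" "?z \<noteq> 0" using coord_v_nonconst by (simp_all add: K_intros)
    have "fls_at (V.spec ?z) (to_ac (snd P) - to_ac y)"
      using fls_at_diff[OF V(2) fls_at_const] by (simp add: V.spec_diff V.spec_v V.spec_const K_intros)
    then show ?thesis
      using z fls_at_nonzero[of "V.spec ?z" "to_ac (snd P) - to_ac y"] fls_at_0_iff[of "V.spec ?z"]
      by (cases "y = snd P") (auto simp: V(3) V.series_ord_def V.spec_eq_0_iff)
  qed
  have "inj_on \<phi> Z"
  proof
    fix P P' assume P: "P \<in> Z" "P' \<in> Z" "\<phi> P = \<phi> P'"
    have "to_ac (fst P) = to_ac (fst P')"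
      using places_above_disjoint[of "\<phi> P" "Some (to_ac (fst P))" "Some (to_ac (fst P'))"] P \<phi>(1) by fastforce
    moreover have "snd P = snd P'" using P \<phi>v by metis
    ultimately show "P = P'" by (simp add: prod_eq_iff)
  qed
  moreover have "\<phi> ` Z \<subseteq> Q"
  proof
    fix ord assume "ord \<in> \<phi> ` Z"
    then obtain P where "P \<in> Z" "ord = \<phi> P" by blast
    then show "ord \<in> Q" using \<phi>(1)[of P] unfolding Q_def S_def R_def by auto
  qed
  ultimately have "int (card Z) = (\<Sum>ord\<in>\<phi> ` Z. 1)" by (simp add: card_image)
  also have "\<dots> \<le> (\<Sum>ord\<in>\<phi> ` Z. max 0 (ord z))"
    by (rule sum_mono) (use \<phi>(2) in force)
  also have "\<dots> \<le> (\<Sum>ord\<in>Q. max 0 (ord z))"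
    by (rule sum_mono2) (use finite \<open>\<phi> ` Z \<subseteq> Q\<close> in auto)
  \<comment> \<open>Positive and negative parts have equal sums because the orders add up to
    0.\<close>
  also have "\<dots> = (\<Sum>ord\<in>Q. ord z + max 0 (- ord z))" by (rule sum.cong) auto
  also have "\<dots> = (\<Sum>ord\<in>Q. max 0 (- ord z))" by (simp add: sum.distrib total)
  finally show ?thesis using that[of Q] finite Qpl by blast
qed

end

section \<open>The lower bound\<close>

context edwards_curve
begin

lemma poly_hom2_to_ac:
  fixes x y :: 'a
  shows "poly_hom (\<lambda>q. poly q (to_ac x)) (to_ac y) (map_poly (map_poly to_ac) p) = to_ac (eval2 p x y)"
proof -
  have 1: "poly (map_poly to_ac q) (to_ac x) = to_ac (poly q x)" for q :: "'a poly"
    by (induction q) (simp_all add: map_poly_pCons)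
  have "poly_hom (\<lambda>q. poly q (to_ac x)) (to_ac y) (map_poly (map_poly to_ac) p) =
      poly_hom (\<lambda>q. to_ac (poly q x)) (to_ac y) p"
    by (rule poly_hom_map) (simp_all add: 1)
  also have "\<dots> = to_ac (eval2 p x y)"
    by (induction p) (simp_all add: poly_hom_0 poly_hom_pCons eval2_def)
  finally show ?thesis .
qed

text \<open>The expansion at P of the translated function has as constant term the value of f at P +
  G; completeness keeps the denominators of P + G nonzero at X = 0.\<close>

lemma trans_value:
  assumes P: "(x, y) \<in> edwards_points c d" and G: "G \<in> edwards_points c d"
    and val: "has_value_at c d f (edwards_add c d (x, y) G) w"
    and UV: "series_point c d U V" "fls_at U (to_ac x)" "fls_at V (to_ac y)"
  shows "fls_at (specialize c d fls_const U V (trans G f)) (to_ac w)"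
proof -
  interpret V: series_point c d U V by (rule UV(1))
  interpret G: generic_point c d geom_const "fst (shift G)" "snd (shift G)"
    by (rule generic_shift[OF G])
  obtain a b where ab: "G = (a, b)" by (cases G)
  define Q where "Q = edwards_add c d (x, y) G"
  obtain p r where r0: "base_fun c d r \<noteq> 0" and f: "f = base_fun c d p / base_fun c d r"
    and r: "eval2 r (fst Q) (snd Q) \<noteq> 0" and w: "w = eval2 p (fst Q) (snd Q) / eval2 r (fst Q) (snd Q)"
    using val unfolding has_value_at_def Q_def by blast
  have reg: "1 + d * a * b * x * y \<noteq> 0" "1 - d * a * b * x * y \<noteq> 0"
    using edwards_complete[OF P G] by (simp_all add: ab edwards_regular_def mult_ac)
  have base: "fls_at (V.spec (base_const e)) (to_ac e)" for e
    by (simp add: V.spec_base_const fls_at_const)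
  have one: "fls_at (V.spec 1) (to_ac 1)" using fls_at_const[of 1] by (simp add: V.spec_1)
  have den: "fls_at (V.spec (base_const c * (1 + coord_u * coord_v c d * base_const e))) (to_ac (c * (1 + x * y * e)))" for e
  proof -
    have "fls_at (V.spec (base_const c) * (V.spec 1 + U * V * V.spec (base_const e)))
       (to_ac c * (to_ac 1 + to_ac x * to_ac y * to_ac e))"
      by (intro fls_at_mult fls_at_add UV base one)
    then show ?thesis by (simp add: V.spec_mult V.spec_add V.spec_u V.spec_v K_intros)
  qed
  have "fls_at (V.spec (fst (shift G))) (to_ac (fst Q))"
  proof -
    have "fls_at (U * V.spec (base_const b) + V.spec (base_const a) * V) (to_ac x * to_ac b + to_ac a * to_ac y)"
      by (intro fls_at_mult fls_at_add UV base)
    from fls_at_divide[OF this den[of "d * a * b"]] show ?thesis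
      using reg c by (simp add: ab shift_eq V.spec_divide V.spec_mult V.spec_add V.spec_u V.spec_v K_intros
        Q_def edwards_add_def mult_ac del: to_ac_add to_ac_diff flip: to_ac_add to_ac_mult to_ac_divide to_ac_diff)
  qed
  moreover have "fls_at (V.spec (snd (shift G))) (to_ac (snd Q))"
  proof -
    have "fls_at (V * V.spec (base_const b) - U * V.spec (base_const a)) (to_ac y * to_ac b - to_ac x * to_ac a)"
      by (intro fls_at_mult fls_at_diff UV base)
    from fls_at_divide[OF this den[of "- (d * a * b)"]] show ?thesis
      using reg c by (simp add: ab shift_eq V.spec_divide V.spec_mult V.spec_diff V.spec_add V.spec_u V.spec_v K_intros
        Q_def edwards_add_def mult_ac del: to_ac_add to_ac_diff flip: to_ac_add to_ac_mult to_ac_divide to_ac_diff)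
  qed
  ultimately have at: "fls_at (V.spec (G.ev2 (map_poly (map_poly to_ac) q))) (to_ac (eval2 q (fst Q) (snd Q)))" for q
    using V.spec_poly_hom2[OF shift_in_K[of G], of "map_poly (map_poly to_ac) q"]
      fls_at_poly_hom2[of "V.spec (fst (shift G))" "to_ac (fst Q)" "V.spec (snd (shift G))" "to_ac (snd Q)" "map_poly (map_poly to_ac) q"]
    by (simp add: poly_hom2_to_ac)
  have "trans G f = G.ev2 (map_poly (map_poly to_ac) p) / G.ev2 (map_poly (map_poly to_ac) r)"
    using r0 unfolding f base_fun_eq_geom_fun trans_def by (rule G.spec_eq)
  then have "V.spec (trans G f) = V.spec (G.ev2 (map_poly (map_poly to_ac) p)) / V.spec (G.ev2 (map_poly (map_poly to_ac) r))"
    using gen.spec_poly_hom2[OF shift_in_K] by (simp add: V.spec_divide)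
  then show ?thesis using fls_at_divide[OF at[of p] at[of r]] r by (simp add: w)
qed

section \<open>Translations fixing a place at infinity\<close>

lemma coord_u_nonzero: "(coord_u :: 'a fun_univ) \<noteq> 0"
proof
  assume "coord_u = (0 :: 'a fun_univ)"
  then have "coord_u = (geom_const 0 :: 'a fun_univ)" by (simp only: gen.h_simps)
  then show False using coord_u_nonconst by blast
qed

lemma coord_v_nonzero: "coord_v c d \<noteq> 0"
  using coord_v_nonconst[of 0] by (simp add: gen.h_simps)

text \<open>The hypothesis on \<open>\<Omega>\<^sub>1\<close> and \<open>\<Omega>\<^sub>2\<close> enters here.\<close>

lemma translation_fixes_infinity:
  assumes ord: "ord \<in> places_over_Omega1 c d \<union> places_over_Omega2 c d"
    and H: "H \<in> edwards_points c d" and T: "\<And>z. z \<in> K \<Longrightarrow> ord (trans H z) = ord z"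
  shows "H = (0, c)"
proof -
  obtain a b where ab: "H = (a, b)" by (cases H)
  let ?u = "coord_u :: 'a fun_univ" and ?v = "coord_v c d"
  have H': "(a, b) \<in> edwards_points c d" "(- a, b) \<in> edwards_points c d"
    using H by (auto simp: ab edwards_points_def)
  interpret H: generic_point c d geom_const "fst (shift H)" "snd (shift H)"
    by (rule generic_shift[OF H])
  have Tu: "trans H ?u = fst (shift H)" and Tv: "trans H ?v = snd (shift H)"
    by (simp_all add: trans_def H.spec_u H.spec_v)
  have Td: "trans H (z - geom_const e) = trans H z - geom_const e" if "z \<in> K" for z e
    using that by (simp add: trans_def H.spec_diff H.spec_const K_intros)
  have curve: "?u^2 + ?v^2 = base_const c^2 * (1 + base_const d * ?u^2 * ?v^2)"
    by (rule coord_v_equation[OF c])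
  then have curve': "?v^2 + ?u^2 = base_const c^2 * (1 + base_const d * ?v^2 * ?u^2)"
    by (simp add: mult_ac add.commute)
  \<comment> \<open>A vanishing first coordinate leaves the neutral element and (0, -c); the latter
    is excluded by \<open>negate_infinity\<close>.\<close>
  have b: "b = c \<or> b = - c" if "a = 0"
    using H' that by (simp add: edwards_points_def power2_eq_iff)
  have place: "ord \<in> places c d" using ord by (auto simp: places_over_Omega1_def places_over_Omega2_def)
  note K = K_u K_v coord_u_nonzero coord_v_nonzero
  show ?thesis
  proof (cases "ord \<in> places_over_Omega1 c d")
    case True
    then have pole: "ord ?u < 0"
      using ord_inverse[OF place K_u coord_u_nonzero] by (simp add: places_over_Omega1_def inverse_eq_divide)
    have Tx: "trans H ?u = (base_const b * ?u + base_const a * ?v) / (base_const c * (1 + base_const (d * a * b) * (?u * ?v)))"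
      unfolding Tu by (simp add: ab shift_eq mult_ac)
    have "a = 0"
      by (rule translate_infinity[OF place K(1,2,3,4) curve pole T Tx H'(1)])
    moreover have "b \<noteq> - c"
    proof
      assume "b = - c"
      then have "trans H (?v - geom_const e) = - ?v - geom_const e" for e
        using \<open>a = 0\<close> c by (simp only: Td[OF K_v] Tv) (simp add: ab shift_eq base_const_simps)
      then show False using T by (intro negate_infinity[OF place K(1,2,3,4) curve pole, of "trans H"])
    qed
    ultimately show ?thesis using b ab by blast
  next
    case False
    then have pole: "ord ?v < 0"
      using ord ord_inverse[OF place K_v coord_v_nonzero] by (simp add: places_over_Omega2_def inverse_eq_divide)
    have Tx: "trans H ?v = (base_const b * ?v + base_const (- a) * ?u) / (base_const c * (1 + base_const (d * - a * b) * (?v * ?u)))"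
      unfolding Tv by (simp add: ab shift_eq base_const_simps mult_ac)
    have "- a = 0"
      by (rule translate_infinity[OF place K(2,1,4,3) curve' pole T Tx H'(2)])
    moreover have "b \<noteq> - c"
    proof
      assume "b = - c"
      then have "trans H (?u - geom_const e) = - ?u - geom_const e" for e
        using \<open>- a = 0\<close> c by (simp only: Td[OF K_u] Tu) (simp add: ab shift_eq base_const_simps)
      then show False using T by (intro negate_infinity[OF place K(2,1,4,3) curve' pole, of "trans H"])
    qed
    ultimately show ?thesis using b ab by auto
  qed
qed

section \<open>Recurrences among translates of f\<close>

abbreviation mult_point :: "'a \<times> 'a \<Rightarrow> nat \<Rightarrow> 'a \<times> 'a" where
  "mult_point G n \<equiv> G [^]\<^bsub>edwards_group c d\<^esub> n"

lemma mult_point: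
  assumes "G \<in> edwards_points c d"
  shows "mult_point G n \<in> edwards_points c d"
    "edwards_add c d (mult_point G m) (mult_point G n) = mult_point G (m + n)"
    "mult_point G 0 = (0, c)" "mult_point G (group.ord (edwards_group c d) G) = (0, c)"
    "inj_on (mult_point G) {1..group.ord (edwards_group c d) G}"
proof -
  interpret comm_group "edwards_group c d" by (rule edwards_group_comm_group)
  have G: "G \<in> carrier (edwards_group c d)" using assms by (simp add: edwards_group_def)
  show "mult_point G n \<in> edwards_points c d"
    using nat_pow_closed[OF G, of n] by (simp add: edwards_group_def)
  show "edwards_add c d (mult_point G m) (mult_point G n) = mult_point G (m + n)"
    using nat_pow_mult[OF G, of m n] by (simp add: edwards_group_def)
  show "mult_point G 0 = (0, c)"
    using nat_pow_0[of G] by (simp add: edwards_group_def)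
  show "mult_point G (group.ord (edwards_group c d) G) = (0, c)"
    using pow_ord_eq_1[OF G] by (simp add: edwards_group_def)
  show "inj_on (mult_point G) {1..group.ord (edwards_group c d) G}"
    by (rule ord_inj'[OF G])
qed

lemma mult_point_neq_zero:
  assumes "G \<in> edwards_points c d" "0 < n" "n < group.ord (edwards_group c d) G"
  shows "mult_point G n \<noteq> (0, c)"
proof -
  let ?t = "group.ord (edwards_group c d) G"
  have "mult_point G n \<noteq> mult_point G ?t"
    using inj_onD[OF mult_point(5)[OF assms(1)], of n ?t] assms(2,3) by auto
  then show ?thesis by (simp add: mult_point(4)[OF assms(1)])
qed

text \<open>Composition with a translation maps Q injectively into the places and turns orders of
  the translated function into orders of f.\<close>

lemma pole_sum_le_degree:
  assumes fin: "finite {ord \<in> places c d. ord f < 0}" and H: "H \<in> edwards_points c d"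
    and Q: "finite Q" "Q \<subseteq> places c d"
  shows "(\<Sum>ord\<in>Q. max 0 (- ord (trans H f))) \<le> int (function_degree c d f)"
proof -
  let ?P = "{ord \<in> places c d. ord f < 0}" and ?g = "\<lambda>ord z. ord (trans H z)"
  have inj: "inj_on ?g Q"
  proof (rule inj_onI)
    fix ord ord' assume *: "ord \<in> Q" "ord' \<in> Q" "?g ord = ?g ord'"
    show "ord = ord'"
      by (rule place_trans_inj[OF H]) (use * Q fun_cong[OF *(3)] in auto)
  qed
  have "(\<Sum>ord\<in>Q. max 0 (- ord (trans H f))) = (\<Sum>ord\<in>?g ` Q. max 0 (- ord f))"
    by (simp add: sum.reindex[OF inj])
  also have "\<dots> = (\<Sum>ord\<in>?g ` Q \<inter> ?P. max 0 (- ord f))"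
    using Q place_trans[OF H] by (intro sum.mono_neutral_right) auto
  also have "\<dots> \<le> (\<Sum>ord\<in>?P. max 0 (- ord f))"
    by (rule sum_mono2[OF fin]) auto
  also have "\<dots> = int (function_degree c d f)"
    unfolding function_degree_def by simp
  finally show ?thesis .
qed

lemma period_le_of_zero_combination:
  fixes L :: nat
  assumes fin: "finite {ord \<in> places c d. ord f < 0}" and f: "f \<in> K"
    and pole: "pole_at_Omega1 c d f \<or> pole_at_Omega2 c d f" and G: "G \<in> edwards_points c d"
    and zero: "trans (mult_point G L) f = (\<Sum>i<L. base_const (a i) * trans (mult_point G i) f)"
  shows "group.ord (edwards_group c d) G \<le> L * function_degree c d f"
proof -
  define t where "t = group.ord (edwards_group c d) G"
  note G' = mult_point[OF G]
  obtain ord where ord: "ord \<in> places_over_Omega1 c d \<union> places_over_Omega2 c d" and neg: "ord f < 0"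
    using pole by (auto simp: pole_at_Omega1_def pole_at_Omega2_def)
  have place: "ord \<in> places c d" using ord by (auto simp: places_over_Omega1_def places_over_Omega2_def)
  have tt: "trans (mult_point G m) (trans (mult_point G n) z) = trans (mult_point G (m + n)) z" if "z \<in> K" for m n z
    using trans_trans[OF G'(1)[of m] G'(1)[of n] that] by (simp add: G'(2))
  have TK: "trans (mult_point G n) z \<in> K" if "z \<in> K" for n z
    by (rule trans_in_K[OF G'(1) that])
  \<comment> \<open>Translating the one relation by nG gives a recurrence for all n, since the
    constants are fixed.\<close>
  have rec: "trans (mult_point G (n + L)) f = (\<Sum>i<L. base_const (a i) * trans (mult_point G (n + i)) f)" for n
  proof -
    interpret H: generic_point c d geom_const "fst (shift (mult_point G n))" "snd (shift (mult_point G n))"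
      by (rule generic_shift[OF G'(1)])
    have base: "H.spec (base_const e) = base_const e" for e
      using H.spec_base_const[of e] by (simp only: base_const_def)
    have "trans (mult_point G n) (trans (mult_point G L) f) =
        (\<Sum>i<L. base_const (a i) * trans (mult_point G n) (trans (mult_point G i) f))"
      unfolding zero by (simp add: trans_def H.spec_sum H.spec_mult base K_intros TK[OF f, unfolded trans_def])
    then show ?thesis using f by (simp add: tt)
  qed
  define S where "S = {i \<in> {1..t}. ord (trans (mult_point G i) f) < 0}"
  have "inj_on (\<lambda>i z. ord (trans (mult_point G i) z)) S"
  proof (rule linorder_inj_onI)
    fix i j assume ij: "i < j" "i \<in> S" "j \<in> S"
    show "(\<lambda>z. ord (trans (mult_point G i) z)) \<noteq> (\<lambda>z. ord (trans (mult_point G j) z))"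
    proof
      assume eq: "(\<lambda>z. ord (trans (mult_point G i) z)) = (\<lambda>z. ord (trans (mult_point G j) z))"
      \<comment> \<open>Undoing the translation by iG, equality of the two places means that
        translation by (j - i)G fixes \<open>ord\<close>.\<close>
      have "mult_point G (j - i) = (0, c)"
      proof (rule translation_fixes_infinity[OF ord G'(1)])
        fix z assume "z \<in> K"
        then obtain y where y: "y \<in> K" "trans (mult_point G i) y = z" by (rule trans_surj[OF G'(1)])
        have "trans (mult_point G (j - i)) z = trans (mult_point G j) y"
          using tt[OF y(1), of "j - i" i] ij(1) by (simp add: y(2))
        then show "ord (trans (mult_point G (j - i)) z) = ord z"
          using fun_cong[OF eq, of y] by (simp add: y(2))
      qed
      moreover have "0 < j - i" "j - i < t" using ij by (auto simp: S_def)
      ultimately show False using mult_point_neq_zero[OF G] by (simp add: t_def)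
    qed
  qed auto
  moreover have "(\<lambda>i z. ord (trans (mult_point G i) z)) ` S \<subseteq> {ord \<in> places c d. ord f < 0}"
    using place_trans[OF G'(1) place] by (auto simp: S_def)
  ultimately have "card S \<le> card {ord \<in> places c d. ord f < 0}"
    using fin by (rule card_inj_on_le)
  also have "\<dots> = (\<Sum>ord\<in>{ord \<in> places c d. ord f < 0}. 1)" by simp
  also have "\<dots> \<le> function_degree c d f"
    unfolding function_degree_def by (rule sum_mono) auto
  finally have S: "card S \<le> function_degree c d f" .
  \<comment> \<open>Each index lies in the window of at most L indices that ends at the next index s
    with a pole. There is one window per element of S, whence the bound on t.\<close>
  have "{1..t} \<subseteq> (\<Union>s\<in>S. {s + 1 - L..s})"
  proof
    fix i assume i: "i \<in> {1..t}"
    define P where "P = (\<lambda>s. i \<le> s \<and> ord (trans (mult_point G s) f) < 0)"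
    define s where "s = (LEAST s. P s)"
    \<comment> \<open>Since tG is neutral, index t gives the original place, a pole of f; so the
      search for s stops within the period.\<close>
    have Pt: "P t" using i neg G'(4) f by (simp add: P_def t_def trans_zero)
    then have Ps: "P s" and st: "s \<le> t" unfolding s_def by (rule LeastI, rule Least_le)
    have "s < i + L"
    proof (rule ccontr)
      \<comment> \<open>Then the L indices before s are all at least i, hence without a pole by
        minimality of s, and the recurrence would make the function at s regular too.\<close>
      assume "\<not> s < i + L"
      then obtain n where n: "s = n + L" "i \<le> n" using le_Suc_ex[of "i + L" s] by auto
      have "ord_ge ord 0 (base_const (a j) * trans (mult_point G (n + j)) f)" if "j < L" for j
      proof (intro ord_ge_const_mult[OF place] ord_geI[OF place] TK f)
        have "\<not> P (n + j)" using not_less_Least[of "n + j" P] that n by (simp add: s_def[symmetric])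
        then show "0 \<le> ord (trans (mult_point G (n + j)) f)" using n by (simp add: P_def)
      qed
      then have "ord_ge ord 0 (trans (mult_point G s) f)"
        unfolding n rec by (intro ord_ge_sum[OF place]) auto
      then show False using Ps placesD(2)[OF place] by (auto simp: P_def ord_ge_def)
    qed
    then have "i \<in> {s + 1 - L..s}" "s \<in> S" using Ps st i by (auto simp: P_def S_def)
    then show "i \<in> (\<Union>s\<in>S. {s + 1 - L..s})" by blast
  qed
  then have "card {1..t} \<le> card (\<Union>s\<in>S. {s + 1 - L..s})"
    by (rule card_mono[rotated]) (simp add: S_def)
  also have "\<dots> \<le> (\<Sum>s\<in>S. card {s + 1 - L..s})"
    by (rule card_UN_le) (simp add: S_def)
  also have "\<dots> \<le> (\<Sum>s\<in>S. L)" by (rule sum_mono) simp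
  also have "\<dots> \<le> L * function_degree c d f" using S by (simp add: mult.commute)
  finally show ?thesis by (simp add: t_def)
qed

lemma zeros_le_of_nonzero_combination:
  fixes L M :: nat
  assumes fin: "finite {ord \<in> places c d. ord f < 0}" and f: "f \<in> K"
    and G: "G \<in> edwards_points c d"
    and val: "\<And>n. 1 \<le> n \<Longrightarrow> has_value_at c d f (mult_point G n) (w n)"
    and rec: "\<And>n. 1 \<le> n \<Longrightarrow> n \<le> M \<Longrightarrow> w (n + L) = (\<Sum>i<L. a i * w (n + i))"
    and M: "M \<le> group.ord (edwards_group c d) G"
    and nonzero: "trans (mult_point G L) f \<noteq> (\<Sum>i<L. base_const (a i) * trans (mult_point G i) f)"
  shows "M \<le> (L + 1) * function_degree c d f"
proof -
  note G' = mult_point[OF G]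
  let ?T = "\<lambda>i. trans (mult_point G i) f"
  define F where "F = ?T L - (\<Sum>i<L. base_const (a i) * ?T i)"
  have TK: "?T n \<in> K" for n by (rule trans_in_K[OF G'(1) f])
  have F: "F \<in> K" "F \<noteq> 0" using nonzero TK by (auto simp: F_def intro!: K_diff K_sum K_mult K_base_const)
  define Z where "Z = mult_point G ` {1..M}"
  have "inj_on (mult_point G) {1..M}" by (rule inj_on_subset[OF G'(5)]) (use M in auto)
  then have card: "card Z = M" by (simp add: Z_def card_image)
  have Z: "finite Z" "Z \<subseteq> edwards_points c d" using G'(1) by (auto simp: Z_def)
  have zero: "fls_at (specialize c d fls_const U V F) 0"
    if P: "(x, y) \<in> Z" and UV: "series_point c d U V" "fls_at U (to_ac x)" "fls_at V (to_ac y)" for x y U V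
  proof -
    interpret V: series_point c d U V by (rule UV(1))
    obtain n where n: "n \<in> {1..M}" "(x, y) = mult_point G n" using P unfolding Z_def by blast
    have at: "fls_at (V.spec (?T i)) (to_ac (w (n + i)))" for i
    proof (rule trans_value[OF _ G'(1) _ UV])
      show "(x, y) \<in> edwards_points c d" unfolding n(2) by (rule G'(1))
      show "has_value_at c d f (edwards_add c d (x, y) (mult_point G i)) (w (n + i))"
      proof -
        have "edwards_add c d (x, y) (mult_point G i) = mult_point G (n + i)"
          by (simp only: n(2) G'(2))
        moreover have "1 \<le> n + i" using n(1) by simp
        ultimately show ?thesis using val[of "n + i"] by simp
      qed
    qed
    have "fls_at (\<Sum>i<l. V.spec (base_const (a i)) * V.spec (?T i)) (\<Sum>i<l. to_ac (a i) * to_ac (w (n + i)))" for l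
    proof (induction l)
      case (Suc l)
      have "fls_at (V.spec (base_const (a l))) (to_ac (a l))"
        unfolding V.spec_base_const by (rule fls_at_const)
      from fls_at_add[OF Suc fls_at_mult[OF this at]] show ?case by (simp only: sum.lessThan_Suc)
    qed (use fls_at_const[of 0] in simp)
    note at_sum = this[of L]
    have "V.spec (\<Sum>i<L. base_const (a i) * ?T i) = (\<Sum>i<L. V.spec (base_const (a i)) * V.spec (?T i))"
      by (subst V.spec_sum) (intro K_mult K_base_const TK, simp only: V.spec_mult K_base_const TK)
    moreover have "V.spec F = V.spec (?T L) - V.spec (\<Sum>i<L. base_const (a i) * ?T i)"
      unfolding F_def by (intro V.spec_diff TK K_sum K_mult K_base_const)
    ultimately have "fls_at (V.spec F) (to_ac (w (n + L)) - (\<Sum>i<L. to_ac (a i) * to_ac (w (n + i))))"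
      using fls_at_diff[OF at[of L] at_sum] by (simp only:)
    moreover have "to_ac (w (n + L)) = (\<Sum>i<L. to_ac (a i) * to_ac (w (n + i)))"
      using rec[of n] n(1) by (simp only: to_ac_sum to_ac_mult atLeastAtMost_iff)
    ultimately show ?thesis by simp
  qed
  obtain Q where Q: "finite Q" "Q \<subseteq> places c d" "int (card Z) \<le> (\<Sum>ord\<in>Q. max 0 (- ord F))"
    by (rule zeros_le_poles[OF F Z zero])
  have "max 0 (- ord F) \<le> (\<Sum>i\<le>L. max 0 (- ord (?T i)))" if "ord \<in> Q" for ord
  proof -
    have place: "ord \<in> places c d" using that Q by blast
    \<comment> \<open>A combination with constant coefficients has a pole of order at most the sum
      of the pole orders of its terms. Summed over Q, each of the L + 1 terms contributes at most
      the degree.\<close>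
    define n where "n = (\<Sum>i\<le>L. max 0 (- ord (?T i)))"
    have "0 \<le> n" unfolding n_def by (rule sum_nonneg) auto
    have ge: "ord_ge ord (- n) (?T i)" if "i \<le> L" for i
    proof (rule ord_geI[OF place TK])
      have "max 0 (- ord (?T i)) \<le> n" unfolding n_def by (rule member_le_sum) (use that in auto)
      then show "- n \<le> ord (?T i)" by simp
    qed
    have "ord_ge ord (- n) F"
      unfolding F_def by (intro ord_ge_diff[OF place] ord_ge_sum[OF place] ord_ge_const_mult[OF place] ge) auto
    then show ?thesis using F(2) \<open>0 \<le> n\<close> by (simp add: ord_ge_def n_def)
  qed
  then have "(\<Sum>ord\<in>Q. max 0 (- ord F)) \<le> (\<Sum>ord\<in>Q. \<Sum>i\<le>L. max 0 (- ord (?T i)))"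
    by (rule sum_mono)
  also have "\<dots> = (\<Sum>i\<le>L. \<Sum>ord\<in>Q. max 0 (- ord (?T i)))" by (rule sum.swap)
  also have "\<dots> \<le> (\<Sum>i\<le>L. int (function_degree c d f))"
    by (rule sum_mono) (rule pole_sum_le_degree[OF fin G'(1) Q(1,2)])
  finally have "int M \<le> int ((L + 1) * function_degree c d f)" using Q(3) card by (simp add: algebra_simps)
  then show ?thesis unfolding of_nat_le_iff .
qed

end

text \<open>In characteristic 2 squaring is additive and injective, so on a finite field it is onto
  and every element is a square.\<close>

lemma nonsquare_imp_two_nonzero:
  fixes d :: "'a::{field,finite}"
  assumes "\<nexists>x. d = x^2"
  shows "(2::'a) \<noteq> 0"
proof
  assume two: "(2::'a) = 0"
  have "inj (\<lambda>x::'a. x^2)"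
  proof (rule injI)
    fix x y :: 'a assume "x^2 = y^2"
    moreover have "(x - y)^2 = x^2 - y^2 + 2 * (y^2 - x * y)" by Groebner_Basis.algebra
    ultimately have "(x - y)^2 = 0" using two by simp
    then show "x = y" by simp
  qed
  then have "surj (\<lambda>x::'a. x^2)" by (rule finite_UNIV_inj_surj[OF finite])
  then show False using assms by (metis surjD)
qed

lemma linear_complexity_recurrence:
  fixes s :: "nat \<Rightarrow> 'a::field"
  shows "linear_complexity s N \<le> N"
    "\<exists>a. \<forall>n. n + linear_complexity s N < N \<longrightarrow>
      s (n + linear_complexity s N) = (\<Sum>i<linear_complexity s N. a i * s (n + i))"
proof -
  let ?P = "\<lambda>L. \<exists>a :: nat \<Rightarrow> 'a. \<forall>n. n + L < N \<longrightarrow> s (n + L) = (\<Sum>i<L. a i * s (n + i))"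
  have *: "?P N" by simp
  show "linear_complexity s N \<le> N" unfolding linear_complexity_def by (rule Least_le[of ?P, OF *])
  show "\<exists>a. \<forall>n. n + linear_complexity s N < N \<longrightarrow>
      s (n + linear_complexity s N) = (\<Sum>i<linear_complexity s N. a i * s (n + i))"
    unfolding linear_complexity_def by (rule LeastI[of ?P, OF *])
qed

theorem theorem1:
  fixes p k t :: nat
    and c d :: "'a::{field,finite}"
    and f :: "'a fun_univ"
    and G :: "'a \<times> 'a"
    and w :: "nat \<Rightarrow> 'a"
  assumes "prime p" and "odd p" and "card (UNIV :: 'a set) = p ^ k"
    and "c \<noteq> 0" and "d \<noteq> 0" and "d \<noteq> 1" and "\<nexists>x. d = x^2"
    and "f \<in> base_function_field c d"
    and "pole_at_Omega1 c d f \<or> pole_at_Omega2 c d f"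
    and "G \<in> edwards_points c d"
    and "group.ord (edwards_group c d) G = t"
    and "\<forall>n\<ge>1. has_value_at c d f (G [^]\<^bsub>edwards_group c d\<^esub> n) (w n)"
  shows "\<forall>N \<ge> function_degree c d f.
    real (linear_complexity (\<lambda>n. w (Suc n)) N) \<ge>
      min ((real t - real (function_degree c d f)) / (4 * real (function_degree c d f)))
          ((real N - real (function_degree c d f)) / (4 * real (function_degree c d f) + 1))"
proof (intro allI impI)
  fix N
  let ?D = "function_degree c d f"
  define L where "L = linear_complexity (\<lambda>n. w (Suc n)) N"
  interpret edwards_curve c d
    by unfold_locales (use assms nonsquare_imp_two_nonzero[OF assms(7)] in auto)
  have f: "f \<in> K" using assms(8) base_function_field_subset by blast
  show "real (linear_complexity (\<lambda>n. w (Suc n)) N) \<ge>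
      min ((real t - real ?D) / (4 * real ?D)) ((real N - real ?D) / (4 * real ?D + 1))"
  proof (cases "?D = 0")
    case True
    \<comment> \<open>This covers an infinite set of poles, whose sum is \<open>0\<close>. The first quotient is \<open>x / 0 = 0\<close>.\<close>
    then show ?thesis by simp
  next
    case False
    then have D: "?D > 0" and fin: "finite {ord \<in> places c d. ord f < 0}"
      unfolding function_degree_def by (auto intro: ccontr)
    \<comment> \<open>With D the degree, the alternatives say L \<ge> (t - D) / D or L \<ge> (N - D)
      / (D + 1). The larger denominators 4 D and 4 D + 1 weaken this, also for negative numerators,
      because L \<ge> 0.\<close>
    have bound: "(real t - real ?D) / (4 * real ?D) \<le> real L \<or> (real N - real ?D) / (4 * real ?D + 1) \<le> real L"
      if "t \<le> (L + 1) * ?D \<or> N - L \<le> (L + 1) * ?D"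
      using that
    proof
      assume "t \<le> (L + 1) * ?D"
      then have "real t \<le> (real L + 1) * real ?D" by (metis of_nat_1 of_nat_add of_nat_le_iff of_nat_mult)
      moreover have "0 \<le> real L * real ?D" by simp
      ultimately have "real t - real ?D \<le> real L * (4 * real ?D)" unfolding distrib_left distrib_right by linarith
      then show ?thesis using D by (simp add: pos_divide_le_eq)
    next
      assume "N - L \<le> (L + 1) * ?D"
      then have "N \<le> (L + 1) * ?D + L" by linarith
      then have "real N \<le> (real L + 1) * real ?D + real L" by (metis of_nat_1 of_nat_add of_nat_le_iff of_nat_mult)
      moreover have "0 \<le> real L * real ?D" by simp
      ultimately have "real N - real ?D \<le> real L * (4 * real ?D + 1)" unfolding distrib_left distrib_right by linarith
      then show ?thesis using D by (simp add: pos_divide_le_eq)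
    qed
    obtain a where a: "\<And>n. n + L < N \<Longrightarrow> w (Suc (n + L)) = (\<Sum>i<L. a i * w (Suc (n + i)))"
      using linear_complexity_recurrence(2)[of "\<lambda>n. w (Suc n)" N] unfolding L_def by blast
    \<comment> \<open>The complexity counts terms from 0 while w starts at 1, so n + L < N becomes n
      \<le> N - L. The minimum with t keeps the points nG distinct.\<close>
    have rec: "w (n + L) = (\<Sum>i<L. a i * w (n + i))" if "1 \<le> n" "n \<le> min (N - L) t" for n
      using a[of "n - 1"] that by (cases n) auto
    have "t \<le> (L + 1) * ?D \<or> N - L \<le> (L + 1) * ?D"
    proof (cases "trans (mult_point G L) f = (\<Sum>i<L. base_const (a i) * trans (mult_point G i) f)")
      case True
      then show ?thesis
        using period_le_of_zero_combination[OF fin f assms(9,10) True] assms(11) by simp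
    next
      case False
      have "min (N - L) t \<le> (L + 1) * ?D"
        by (rule zeros_le_of_nonzero_combination[OF fin f assms(10) _ rec _ False])
          (use assms(11,12) in auto)
      then show ?thesis by linarith
    qed
    from bound[OF this] show ?thesis unfolding L_def by linarith
  qed
qed

end
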